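(* Let $K$ be a compact subset of $\mathbb{R}^d$ which is Ahlfors regular. Then a typical measure $\mu\in\mathcal{P}(K)$ satisfies: for $\mu$-almost every $x\in K$, $\overline{\dim}_{\rm loc}(\mu;x)=\dim_{\mathcal P}(K)$.
   Context: A compact set $K\subset\mathbb{R}^d$ is Ahlfors regular if there are positive constants $s,c_1,c_2,r_0>0$ such that $\dim_{\mathcal H}(K)=s$ and $c_1r^s\leq\mathcal{H}^s(K\cap B(x,r))\leq c_2r^s$ for all $x\in K$ and all $0<r<r_0$, where $\mathcal{H}^s$ is $s$-dimensional Hausdorff measure and $\dim_{\mathcal H}$ is Hausdorff dimension. $\dim_{\mathcal P}$ is packing dimension. $\mathcal{P}(K)$ is the set of Borel probability measures on $K$, endowed with the weak topology (which is completely metrizable). A property is true for a typical measure of $\mathcal{P}(K)$ if it is satisfied by all elements of a dense $G_\delta$ subset of $\mathcal{P}(K)$. For $\mu\in\mathcal{P}(K)$ and $x\in K$, the upper local dimension is $\overline{\dim}_{\rm loc}(\mu;x)=\limsup_{r\to 0}\frac{\log\mu(B(x,r))}{\log r}$ (with $\log 0=-\infty$, so it is $+\infty$ off the support of $\mu$). *)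

theory Defs
  imports "HOL-Probability.Probability"
begin

section \<open>Hausdorff measure and dimension\<close>

text \<open>The cases make \<open>diam(\<emptyset>)\<^sup>s = 0\<close> and \<open>diam(U)\<^sup>0 = 1\<close> for nonempty \<open>U\<close>; plain \<^const>\<open>powr\<close>
  would give \<open>0\<close> for a singleton and \<open>s = 0\<close>.\<close>

definition diam_pow :: "real \<Rightarrow> 'a::metric_space set \<Rightarrow> ennreal" where
  "diam_pow s U = (if U = {} then 0 else if s = 0 then 1 else ennreal (diameter U powr s))"

text \<open>Boundedness is required explicitly because \<^const>\<open>diameter\<close> is unspecified on unbounded sets.\<close>

definition hausdorff_premeasure :: "real \<Rightarrow> real \<Rightarrow> 'a::metric_space set \<Rightarrow> ennreal" where
  "hausdorff_premeasure s \<delta> A =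
     (INF U \<in> {U :: nat \<Rightarrow> 'a set. A \<subseteq> (\<Union>i. U i) \<and> (\<forall>i. bounded (U i) \<and> diameter (U i) \<le> \<delta>)}.
        \<Sum>i. diam_pow s (U i))"

definition hausdorff_measure :: "real \<Rightarrow> 'a::metric_space set \<Rightarrow> ennreal" where
  "hausdorff_measure s A = (SUP \<delta> \<in> {0<..}. hausdorff_premeasure s \<delta> A)"

definition hausdorff_dim :: "'a::metric_space set \<Rightarrow> ereal" where
  "hausdorff_dim A = Inf {ereal s |s. 0 \<le> s \<and> hausdorff_measure s A = 0}"

definition ahlfors_regular :: "'a::metric_space set \<Rightarrow> bool" where
  "ahlfors_regular K \<longleftrightarrow>
     (\<exists>s c1 c2 r0. 0 < s \<and> 0 < c1 \<and> 0 < c2 \<and> 0 < r0 \<and>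
        hausdorff_dim K = ereal s \<and>
        (\<forall>x\<in>K. \<forall>r. 0 < r \<and> r < r0 \<longrightarrow>
           ennreal (c1 * r powr s) \<le> hausdorff_measure s (K \<inter> ball x r) \<and>
           hausdorff_measure s (K \<inter> ball x r) \<le> ennreal (c2 * r powr s)))"

section \<open>Packing measure and dimension\<close>

text \<open>A packing is encoded by the set of its (centre, radius) pairs.\<close>

definition packings :: "real \<Rightarrow> 'a::metric_space set \<Rightarrow> ('a \<times> real) set set" where
  "packings \<delta> A =
     {F. countable F \<and> (\<forall>(x, r)\<in>F. x \<in> A \<and> 0 < r \<and> r \<le> \<delta>) \<and>
         disjoint_family_on (\<lambda>(x, r). cball x r) F}"

definition packing_premeasure :: "real \<Rightarrow> 'a::metric_space set \<Rightarrow> ennreal" where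
  "packing_premeasure s A =
     (INF \<delta> \<in> {0<..}. SUP F \<in> packings \<delta> A. \<Sum>\<^sub>\<infinity>(x, r)\<in>F. ennreal ((2 * r) powr s))"

text \<open>The premeasure is only finitely subadditive, hence the further infimum over countable covers.\<close>

definition packing_measure :: "real \<Rightarrow> 'a::metric_space set \<Rightarrow> ennreal" where
  "packing_measure s A =
     (INF E \<in> {E :: nat \<Rightarrow> 'a set. A \<subseteq> (\<Union>i. E i)}. \<Sum>i. packing_premeasure s (E i))"

definition packing_dim :: "'a::metric_space set \<Rightarrow> ereal" where
  "packing_dim A = Inf {ereal s |s. 0 \<le> s \<and> packing_measure s A = 0}"

section \<open>The space of Borel probability measures\<close>

definition borel_prob_measures :: "'a::topological_space set \<Rightarrow> 'a measure set" where
  "borel_prob_measures K = {\<mu>. prob_space \<mu> \<and> sets \<mu> = sets (restrict_space borel K)}"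

text \<open>The coarsest topology making \<open>\<mu> \<mapsto> \<integral> f d\<mu>\<close> continuous for every bounded
  continuous \<open>f : K \<rightarrow> \<real>\<close>.\<close>

definition weak_topology :: "'a::topological_space set \<Rightarrow> 'a measure topology" where
  "weak_topology K =
     topology_generated_by
       {{\<mu> \<in> borel_prob_measures K. (\<integral>x. f x \<partial>\<mu>) \<in> U} |f U.
          continuous_on K (f :: 'a \<Rightarrow> real) \<and> bounded (f ` K) \<and> open U}"

definition typical_in :: "'b topology \<Rightarrow> ('b \<Rightarrow> bool) \<Rightarrow> bool" where
  "typical_in X P \<longleftrightarrow>
     (\<exists>G. gdelta_in X G \<and> X closure_of G = topspace X \<and> (\<forall>\<mu>\<in>G. P \<mu>))"

section \<open>Local dimension\<close>

text \<open>Unlike \<^const>\<open>ln\<close>, this takes the value \<open>- \<infinity>\<close> at \<open>0\<close>.\<close>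

definition ln_ereal :: "real \<Rightarrow> ereal" where
  "ln_ereal p = (if p = 0 then - \<infinity> else ereal (ln p))"

text \<open>The ball is intersected with the space of \<open>\<mu>\<close> because \<^const>\<open>measure\<close> returns \<open>0\<close> on sets
  outside the \<open>\<sigma>\<close>-algebra, which for a measure on \<open>K\<close> contains only subsets of \<open>K\<close>.\<close>

definition upper_local_dim :: "'a::metric_space measure \<Rightarrow> 'a \<Rightarrow> ereal" where
  "upper_local_dim \<mu> x =
     Limsup (at_right 0) (\<lambda>r. ln_ereal (measure \<mu> (ball x r \<inter> space \<mu>)) / ereal (ln r))"

end

theory Submission
  imports Defs
begin

text \<open>For an Ahlfors regular set of exponent \<open>s\<close>, counting disjoint balls by their Hausdorff measure
  bounds the packing dimension by \<open>s\<close> and, with Borel--Cantelli, the upper local dimension of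
  every measure by \<open>s\<close> almost everywhere. For the converse inequality, let \<open>G\<close> consist of the measures
  \<open>\<mu>\<close> such that for every \<open>n\<close> there is a scale \<open>r < 1/n\<close> at which all balls satisfy
  \<open>\<mu>(B(x,r)) < r\<^sup>t\<close> with \<open>t = s - 1/n\<close>, the condition being tested on finitely many tent functions
  so that it is weakly open. Every measure in \<open>G\<close> has upper local dimension at least \<open>s\<close> at every
  point, and \<open>G\<close> contains all measures with \<open>\<mu>(B(x,r)) \<le> C r\<^sup>s\<close>. These are dense: replace a given
  measure by a convex combination of normalised restrictions of Hausdorff measure to small balls.
  So \<open>G\<close> is dense without any appeal to Baire's theorem.\<close>

section \<open>Hausdorff measure as a Borel measure\<close>

lemma diam_pow_empty [simp]: "diam_pow s {} = 0"
  by (simp add: diam_pow_def)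

lemma diam_pow_le:
  assumes "diameter U \<le> d" "bounded U" "0 \<le> s" "0 < d"
  shows "diam_pow s U \<le> ennreal (d powr s)"
proof -
  have "diameter U powr s \<le> d powr s"
    using assms diameter_ge_0[of U] by (intro powr_mono2) auto
  then show ?thesis
    using assms by (auto simp: diam_pow_def intro: ennreal_leI)
qed

lemma hausdorff_premeasure_le:
  assumes "A \<subseteq> (\<Union>i. U i)" "\<And>i. bounded (U i)" "\<And>i. diameter (U i) \<le> \<delta>"
  shows "hausdorff_premeasure s \<delta> A \<le> (\<Sum>i. diam_pow s (U i))"
  unfolding hausdorff_premeasure_def using assms by (intro INF_lower) auto

lemma hausdorff_premeasure_mono:
  assumes "A \<subseteq> B" "\<epsilon> \<le> \<delta>"
  shows "hausdorff_premeasure s \<delta> A \<le> hausdorff_premeasure s \<epsilon> B"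
  unfolding hausdorff_premeasure_def using assms
  by (intro INF_superset_mono) (auto intro: order_trans)

lemma hausdorff_premeasure_empty:
  assumes "0 \<le> \<delta>"
  shows "hausdorff_premeasure s \<delta> {} = 0"
  using hausdorff_premeasure_le[of "{}" "\<lambda>_. {}" \<delta> s] assms by simp

text \<open>When the right-hand sum is finite, every \<open>A i\<close> has a cover that is optimal
  up to \<open>e / 2^(i+1)\<close>. Enumerating all these covers in one sequence through
  \<open>prod_decode\<close> covers the union at a total loss of \<open>e\<close>.\<close>

lemma hausdorff_premeasure_UN_le:
  "hausdorff_premeasure s \<delta> (\<Union>i::nat. A i) \<le> (\<Sum>i. hausdorff_premeasure s \<delta> (A i))"
proof (rule ennreal_le_epsilon)
  fix e :: real
  assume fin: "(\<Sum>i. hausdorff_premeasure s \<delta> (A i)) < \<top>" and "0 < e"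
  have "\<exists>U. A i \<subseteq> (\<Union>j. U j) \<and> (\<forall>j. bounded (U j) \<and> diameter (U j) \<le> \<delta>) \<and>
      (\<Sum>j. diam_pow s (U j)) \<le> hausdorff_premeasure s \<delta> (A i) + ennreal (e * (1/2) ^ Suc i)" for i
  proof -
    have "hausdorff_premeasure s \<delta> (A i) < hausdorff_premeasure s \<delta> (A i) + ennreal (e * (1/2) ^ Suc i)"
      using ennreal_suminf_lessD[OF fin, of i] \<open>0 < e\<close>
      by (simp add: less_top[symmetric] ennreal_less_zero_iff)
    then show ?thesis
      unfolding hausdorff_premeasure_def by (subst (asm) INF_less_iff) (auto intro: less_imp_le)
  qed
  then obtain U where U: "\<And>i. A i \<subseteq> (\<Union>j. U i j)"
      "\<And>i j. bounded (U i j)" "\<And>i j. diameter (U i j) \<le> \<delta>"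
      "\<And>i. (\<Sum>j. diam_pow s (U i j)) \<le> hausdorff_premeasure s \<delta> (A i) + ennreal (e * (1/2) ^ Suc i)"
    by metis
  define V where "V n = case_prod U (prod_decode n)" for n
  have "(\<Union>i. A i) \<subseteq> (\<Union>n. V n)"
  proof
    fix x assume "x \<in> (\<Union>i. A i)"
    then obtain i j where "x \<in> U i j" using U(1) by blast
    then have "x \<in> V (prod_encode (i, j))" by (simp add: V_def)
    then show "x \<in> (\<Union>n. V n)" by blast
  qed
  moreover have "bounded (V n)" "diameter (V n) \<le> \<delta>" for n
    using U(2,3) by (auto simp: V_def split: prod.splits)
  ultimately have "hausdorff_premeasure s \<delta> (\<Union>i. A i) \<le> (\<Sum>n. diam_pow s (V n))"
    by (rule hausdorff_premeasure_le)
  also have "\<dots> = (\<Sum>i. \<Sum>j. diam_pow s (U i j))"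
    using suminf_ennreal_2dimen[of "\<lambda>i. \<Sum>j. diam_pow s (U i j)" "\<lambda>p. diam_pow s (case_prod U p)"]
    by (simp add: V_def)
  also have "\<dots> \<le> (\<Sum>i. hausdorff_premeasure s \<delta> (A i) + ennreal (e * (1/2) ^ Suc i))"
    by (intro suminf_le U(4)) auto
  also have "\<dots> = (\<Sum>i. hausdorff_premeasure s \<delta> (A i)) + (\<Sum>i. ennreal (e * (1/2) ^ Suc i))"
    by (rule suminf_add[symmetric]) auto
  also have "(\<Sum>i. ennreal (e * (1/2) ^ Suc i)) = ennreal e"
    using \<open>0 < e\<close> sums_mult[OF power_half_series, of e]
    by (intro sums_unique[symmetric]) (auto simp del: power_Suc)
  finally show "hausdorff_premeasure s \<delta> (\<Union>i. A i) \<le> (\<Sum>i. hausdorff_premeasure s \<delta> (A i)) + ennreal e" .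
qed

section \<open>The Hausdorff outer measure and its additivity on separated sets\<close>

lemma hausdorff_premeasure_le_measure:
  "0 < \<delta> \<Longrightarrow> hausdorff_premeasure s \<delta> A \<le> hausdorff_measure s A"
  unfolding hausdorff_measure_def by (intro SUP_upper) auto

lemma hausdorff_measure_mono: "A \<subseteq> B \<Longrightarrow> hausdorff_measure s A \<le> hausdorff_measure s B"
  unfolding hausdorff_measure_def by (intro SUP_mono' hausdorff_premeasure_mono) auto

lemma hausdorff_measure_empty [simp]: "hausdorff_measure s {} = 0"
  unfolding hausdorff_measure_def by (auto simp: hausdorff_premeasure_empty intro!: SUP_eq_const)

lemma hausdorff_measure_UN_le:
  "hausdorff_measure s (\<Union>i::nat. A i) \<le> (\<Sum>i. hausdorff_measure s (A i))"
proof -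
  have "hausdorff_premeasure s \<delta> (\<Union>i. A i) \<le> (\<Sum>i. hausdorff_measure s (A i))" if "0 < \<delta>" for \<delta>
    using hausdorff_premeasure_UN_le
    by (rule order_trans) (intro suminf_le hausdorff_premeasure_le_measure that summableI)
  then show ?thesis
    unfolding hausdorff_measure_def[of s "\<Union>i. A i"] by (intro SUP_least) auto
qed

lemma hausdorff_measure_Un_le:
  "hausdorff_measure s (A \<union> B) \<le> hausdorff_measure s A + hausdorff_measure s B"
proof -
  have "(\<Sum>i. hausdorff_measure s (binaryset A B i)) = hausdorff_measure s A + hausdorff_measure s B"
    using binaryset_sums[of "hausdorff_measure s" A B] by (simp add: sums_iff)
  then show ?thesis
    using hausdorff_measure_UN_le[of s "binaryset A B"] by (simp add: UN_binaryset_eq)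
qed

text \<open>A set of diameter below \<open>d\<close> cannot meet both \<open>A\<close> and
  \<open>B\<close>. Hence for \<open>\<delta> < d\<close> every cover of the union splits into a
  cover of \<open>A\<close> and a cover of \<open>B\<close> that share no member.\<close>

lemma hausdorff_measure_Un_separated:
  fixes A B :: "'a::metric_space set"
  assumes "0 < d" and sep: "\<And>x y. x \<in> A \<Longrightarrow> y \<in> B \<Longrightarrow> d \<le> dist x y"
  shows "hausdorff_measure s A + hausdorff_measure s B \<le> hausdorff_measure s (A \<union> B)"
proof -
  have small: "hausdorff_premeasure s \<delta> A + hausdorff_premeasure s \<delta> B \<le> hausdorff_premeasure s \<delta> (A \<union> B)"
    if \<delta>: "0 < \<delta>" "\<delta> < d" for \<delta>
    unfolding hausdorff_premeasure_def[of s \<delta> "A \<union> B"]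
  proof (intro INF_greatest)
    fix U :: "nat \<Rightarrow> 'a set"
    assume "U \<in> {U. A \<union> B \<subseteq> (\<Union>i. U i) \<and> (\<forall>i. bounded (U i) \<and> diameter (U i) \<le> \<delta>)}"
    then have U: "A \<union> B \<subseteq> (\<Union>i. U i)" "\<And>i. bounded (U i)" "\<And>i. diameter (U i) \<le> \<delta>" by auto
    \<comment> \<open>Members that miss \<open>C\<close> are replaced by the empty set, whose
      \<open>diam_pow\<close> is 0, so the indexing of the cover stays the same.\<close>
    define V where "V C i = (if U i \<inter> C = {} then {} else U i)" for C i
    have V: "hausdorff_premeasure s \<delta> C \<le> (\<Sum>i. diam_pow s (V C i))" if "C \<subseteq> A \<union> B" for C
    proof (rule hausdorff_premeasure_le)
      show "C \<subseteq> (\<Union>i. V C i)" using U(1) that by (fastforce simp: V_def)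
    qed (use U(2,3) \<delta> in \<open>auto simp: V_def\<close>)
    have "V A i = {} \<or> V B i = {}" for i
    proof (rule ccontr)
      assume "\<not> ?thesis"
      then obtain x y where "x \<in> U i" "x \<in> A" "y \<in> U i" "y \<in> B"
        by (auto simp: V_def split: if_splits)
      then show False
        using sep[of x y] diameter_bounded_bound[OF U(2), of x i y] U(3)[of i] \<delta> by simp
    qed
    then have *: "diam_pow s (V A i) + diam_pow s (V B i) \<le> diam_pow s (U i)" for i
      by (metis V_def add_0 add.right_neutral diam_pow_empty order_refl zero_le)
    have "hausdorff_premeasure s \<delta> A + hausdorff_premeasure s \<delta> B
        \<le> (\<Sum>i. diam_pow s (V A i)) + (\<Sum>i. diam_pow s (V B i))"
      by (intro add_mono V) auto
    also have "\<dots> = (\<Sum>i. diam_pow s (V A i) + diam_pow s (V B i))"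
      by (rule suminf_add) auto
    also have "\<dots> \<le> (\<Sum>i. diam_pow s (U i))"
      by (intro suminf_le *) auto
    finally show "hausdorff_premeasure s \<delta> A + hausdorff_premeasure s \<delta> B \<le> (\<Sum>i. diam_pow s (U i))" .
  qed
  \<comment> \<open>The premeasures grow as \<open>\<delta>\<close> shrinks, so both suprema can be
    approached along the same \<open>\<delta>\<close>.\<close>
  have "hausdorff_measure s A + hausdorff_measure s B
      = (SUP \<delta> \<in> {0<..}. hausdorff_premeasure s \<delta> A + hausdorff_premeasure s \<delta> B)"
    unfolding hausdorff_measure_def
  proof (rule SUP_add_directed_ennreal[symmetric])
    fix i j :: real assume "i \<in> {0<..}" "j \<in> {0<..}"
    then show "\<exists>k\<in>{0<..}. hausdorff_premeasure s i A + hausdorff_premeasure s j B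
        \<le> hausdorff_premeasure s k A + hausdorff_premeasure s k B"
      by (intro bexI[of _ "min i j"] add_mono hausdorff_premeasure_mono) auto
  qed
  also have "\<dots> \<le> hausdorff_measure s (A \<union> B)"
  proof (intro SUP_least)
    fix \<delta> :: real assume "\<delta> \<in> {0<..}"
    define \<eta> where "\<eta> = min \<delta> (d / 2)"
    have \<eta>: "0 < \<eta>" "\<eta> < d" "\<eta> \<le> \<delta>" using \<open>\<delta> \<in> {0<..}\<close> \<open>0 < d\<close> by (auto simp: \<eta>_def)
    have "hausdorff_premeasure s \<delta> A + hausdorff_premeasure s \<delta> B
        \<le> hausdorff_premeasure s \<eta> A + hausdorff_premeasure s \<eta> B"
      using \<eta> by (intro add_mono hausdorff_premeasure_mono) auto
    also have "\<dots> \<le> hausdorff_premeasure s \<eta> (A \<union> B)" using small \<eta> by blast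
    also have "\<dots> \<le> hausdorff_measure s (A \<union> B)" using \<eta> by (intro hausdorff_premeasure_le_measure) auto
    finally show "hausdorff_premeasure s \<delta> A + hausdorff_premeasure s \<delta> B \<le> hausdorff_measure s (A \<union> B)" .
  qed
  finally show ?thesis .
qed

text \<open>The classical argument for metric outer measures: \<open>A - C\<close> is exhausted by the sets
  \<open>E n\<close> of its points at distance at least \<open>1/(n+1)\<close> from \<open>C\<close>, and the rings
  \<open>E (n+1) - E n\<close> of the same parity are separated from each other, so their measures are summable.\<close>

lemma hausdorff_measure_closed_split:
  fixes A C :: "'a::metric_space set"
  assumes "closed C" "C \<noteq> {}"
  shows "hausdorff_measure s (A \<inter> C) + hausdorff_measure s (A - C) \<le> hausdorff_measure s A"
proof (cases "hausdorff_measure s A = \<top>")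
  case False
  define H :: "'a set \<Rightarrow> ennreal" where "H = hausdorff_measure s"
  note H_mono = hausdorff_measure_mono[where 'a='a and s=s, folded H_def]
  note H_sep = hausdorff_measure_Un_separated[where 'a='a and s=s, folded H_def]
  define E where "E n = {x \<in> A. 1 / real (Suc n) \<le> infdist x C}" for n
  define R where "R n = E (Suc n) - E n" for n
  have E_mono: "E m \<subseteq> E n" if "m \<le> n" for m n
  proof -
    have "1 / real (Suc n) \<le> 1 / real (Suc m)" using that by (simp add: field_simps)
    then show ?thesis by (auto simp: E_def)
  qed
  \<comment> \<open>The distance to \<open>C\<close> is a 1-Lipschitz function.\<close>
  have E_sep: "1 / real (Suc m) - 1 / real (Suc n) \<le> dist x y" if "x \<in> E m" "infdist y C \<le> 1 / real (Suc n)" for x y m n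
    using that infdist_triangle[of x C y] by (auto simp: E_def)
  \<comment> \<open>The omitted ring \<open>R n\<close> is the gap: points of \<open>E n\<close>
    have distance at least \<open>1/(n+1)\<close> from \<open>C\<close>, points of
    \<open>R (Suc n)\<close> have distance less than \<open>1/(n+2)\<close>.\<close>
  have R_sep: "H (E n) + H (R (Suc n)) \<le> H (E n \<union> R (Suc n))" for n
  proof (rule H_sep)
    show "0 < 1 / real (Suc n) - 1 / real (Suc (Suc n))" by (simp add: frac_less2)
    show "1 / real (Suc n) - 1 / real (Suc (Suc n)) \<le> dist x y" if "x \<in> E n" "y \<in> R (Suc n)" for x y
      using that by (intro E_sep) (auto simp: R_def E_def)
  qed
  have RE: "E n \<union> R (Suc n) \<subseteq> E (Suc (Suc n))" for n
    using E_mono[of n "Suc (Suc n)"] by (auto simp: R_def)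
  have H_step: "H (E n) + H (R (Suc n)) \<le> H (E (Suc (Suc n)))" for n
    using R_sep[of n] H_mono[OF RE[of n]] by (rule order_trans)
  have odd_rings: "(\<Sum>k<n. H (R (Suc (2 * k)))) \<le> H (E (2 * n))" for n
  proof (induction n)
    case (Suc n)
    have "(\<Sum>k<Suc n. H (R (Suc (2 * k)))) \<le> H (E (2 * n)) + H (R (Suc (2 * n)))"
      using Suc by (simp add: add_right_mono)
    also have "\<dots> \<le> H (E (2 * Suc n))" using H_step[of "2 * n"] by simp
    finally show ?case .
  qed simp
  have even_rings: "(\<Sum>k<n. H (R (Suc (Suc (2 * k))))) \<le> H (E (Suc (2 * n)))" for n
  proof (induction n)
    case (Suc n)
    have "(\<Sum>k<Suc n. H (R (Suc (Suc (2 * k))))) \<le> H (E (Suc (2 * n))) + H (R (Suc (Suc (2 * n))))"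
      using Suc by (simp add: add_right_mono)
    also have "\<dots> \<le> H (E (Suc (2 * Suc n)))" using H_step[of "Suc (2 * n)"] by simp
    finally show ?case .
  qed simp
  have EA: "H (E n) \<le> H A" for n by (intro H_mono) (auto simp: E_def)
  \<comment> \<open>Each parity class contributes at most \<open>H A\<close>. Going up to
    \<open>2 * n\<close> makes the sum split evenly into the two classes.\<close>
  have "(\<Sum>k<n. H (R (Suc k))) \<le> H A + H A" for n
  proof -
    have "(\<Sum>k<n. H (R (Suc k))) \<le> (\<Sum>k<2*n. H (R (Suc k)))"
      by (intro sum_mono2) auto
    also have "\<dots> = (\<Sum>k<n. H (R (Suc (2 * k)))) + (\<Sum>k<n. H (R (Suc (Suc (2 * k)))))"
      by (induction n) (auto simp: algebra_simps)
    also have "\<dots> \<le> H A + H A"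
      by (intro add_mono order_trans[OF odd_rings EA] order_trans[OF even_rings EA])
    finally show ?thesis .
  qed
  then have "(\<Sum>k. H (R (Suc k))) \<le> H A + H A"
    by (intro suminf_le_const) auto
  then have fin: "(\<Sum>k. H (R (Suc k))) \<noteq> \<top>"
    using False by (auto simp: H_def top_unique)
  have tail: "(\<lambda>n. \<Sum>k. H (R (Suc (k + n)))) \<longlonglongrightarrow> 0"
  proof -
    let ?f = "\<lambda>k. H (R (Suc k))"
    have "(\<Sum>k. ?f (k + n)) = suminf ?f - (\<Sum>k<n. ?f k)" for n
    proof -
      have "(\<Sum>k<n. ?f k) \<noteq> \<top>"
        using fin sum_le_suminf[of ?f "{..<n}"] by (metis finite_lessThan summableI top_unique zero_le)
      then show ?thesis
        using suminf_offset[of ?f n] by (simp add: ennreal_add_diff_cancel_right)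
    qed
    moreover have "(\<lambda>n. suminf ?f - (\<Sum>k<n. ?f k)) \<longlonglongrightarrow> suminf ?f - suminf ?f"
      using fin by (intro tendsto_diff_ennreal tendsto_const summable_LIMSEQ) auto
    ultimately show ?thesis using fin by (simp add: ennreal_minus_eq_0)
  qed
  have "H (A \<inter> C) + H (A - C) \<le> H A + (\<Sum>k. H (R (Suc (k + n))))" for n
  proof -
    have AC: "A - C \<subseteq> E (Suc n) \<union> (\<Union>k. R (Suc (k + n)))"
    proof
      fix x assume x: "x \<in> A - C"
      have "0 < infdist x C"
        using x assms by (simp add: infdist_pos_not_in_closed)
      then obtain N where N: "1 / real (Suc N) \<le> infdist x C"
        using nat_approx_posE less_imp_le by metis
      \<comment> \<open>The first \<open>E m\<close> that contains \<open>x\<close> decides where it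
        goes: either \<open>m\<close> is at most \<open>Suc n\<close>, or \<open>x\<close> was added
        in the ring \<open>R (m - 1)\<close>, which belongs to the tail.\<close>
      define m where "m = (LEAST m. x \<in> E m)"
      have "x \<in> E N" using N x by (auto simp: E_def)
      then have m: "x \<in> E m" unfolding m_def by (rule LeastI)
      show "x \<in> E (Suc n) \<union> (\<Union>k. R (Suc (k + n)))"
      proof (cases "m \<le> Suc n")
        case True
        then show ?thesis using m E_mono by blast
      next
        case False
        then obtain k where k: "m = Suc (Suc (k + n))"
          by (metis add.commute less_imp_Suc_add not_le add_Suc_right add_Suc)
        have "x \<notin> E (Suc (k + n))" using not_less_Least[of "Suc (k + n)" "\<lambda>m. x \<in> E m"] k
          by (auto simp: m_def)
        then have "x \<in> R (Suc (k + n))" using m k by (auto simp: R_def)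
        then show ?thesis by blast
      qed
    qed
    have "H (A - C) \<le> H (E (Suc n)) + H (\<Union>k. R (Suc (k + n)))"
      using H_mono[OF AC] hausdorff_measure_Un_le[where 'a='a and s=s, folded H_def] by (rule order_trans)
    also have "\<dots> \<le> H (E (Suc n)) + (\<Sum>k. H (R (Suc (k + n))))"
      using hausdorff_measure_UN_le[where 'a='a and s=s, folded H_def] by (rule add_left_mono)
    finally have "H (A \<inter> C) + H (A - C) \<le> H (A \<inter> C) + H (E (Suc n)) + (\<Sum>k. H (R (Suc (k + n))))"
      by (simp add: add.assoc add_left_mono)
    \<comment> \<open>Points of \<open>E (Suc n)\<close> keep a fixed distance from
      \<open>C\<close>, so additivity on separated sets applies.\<close>
    also have "H (A \<inter> C) + H (E (Suc n)) \<le> H (A \<inter> C \<union> E (Suc n))"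
    proof (rule H_sep)
      show "0 < 1 / real (Suc (Suc n))" by simp
      show "1 / real (Suc (Suc n)) \<le> dist x y" if "x \<in> A \<inter> C" "y \<in> E (Suc n)" for x y
        using that infdist_le[of x C y] by (auto simp: E_def dist_commute)
    qed
    also have "H (A \<inter> C \<union> E (Suc n)) \<le> H A" by (intro H_mono) (auto simp: E_def)
    finally show ?thesis by (simp add: add_right_mono)
  qed
  moreover have "(\<lambda>n. H A + (\<Sum>k. H (R (Suc (k + n))))) \<longlonglongrightarrow> H A + 0"
    by (intro tendsto_add tail) auto
  ultimately have "H (A \<inter> C) + H (A - C) \<le> H A + 0"
    by (intro LIMSEQ_le_const) auto
  then show ?thesis by (simp add: H_def)
qed simp

section \<open>Caratheodory's construction on the Borel sets\<close>

text \<open>\<open>measure_of\<close> falls back to the zero measure unless it is given a measure on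
  the generated sigma-algebra. That this does not happen here is the content of
  \<open>emeasure_hausdorff_borel\<close>.\<close>

definition hausdorff_borel :: "real \<Rightarrow> 'a::metric_space measure" where
  "hausdorff_borel s = measure_of UNIV (sets borel) (hausdorff_measure s)"

lemma sets_hausdorff_borel [measurable_cong, simp]: "sets (hausdorff_borel s) = sets borel"
  unfolding hausdorff_borel_def using sets.sets_measure_of_eq[of borel] by simp

lemma space_hausdorff_borel [simp]: "space (hausdorff_borel s) = UNIV"
  by (simp add: hausdorff_borel_def)

lemma outer_measure_space_hausdorff: "outer_measure_space UNIV (hausdorff_measure s)"
  unfolding outer_measure_space_def positive_def increasing_def countably_subadditive_def
  by (auto intro: hausdorff_measure_mono hausdorff_measure_UN_le)

text \<open>The Caratheodory measurable sets form a sigma-algebra, and the splitting inequality for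
  closed sets puts the generators of the Borel sets into it.\<close>

lemma borel_subset_lambda_system:
  "sets (borel :: 'a::metric_space measure) \<subseteq> lambda_system UNIV UNIV (hausdorff_measure s)"
proof -
  interpret P: sigma_algebra UNIV "UNIV :: 'a set set"
    using sigma_algebra_Pow[of UNIV] by simp
  have *: "hausdorff_measure s (x \<inter> C) + hausdorff_measure s (x - C) = hausdorff_measure s x" if "closed C" for x C :: "'a set"
  proof (cases "C = {}")
    case False
    have "hausdorff_measure s x \<le> hausdorff_measure s (x \<inter> C) + hausdorff_measure s (x - C)"
      using hausdorff_measure_Un_le[of s "x \<inter> C" "x - C"] by (simp add: Int_Diff_Un)
    then show ?thesis using hausdorff_measure_closed_split[OF that False] by (intro antisym) auto
  qed simp
  have "Collect closed \<subseteq> lambda_system UNIV UNIV (hausdorff_measure s :: 'a set \<Rightarrow> _)"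
    using * unfolding P.lambda_system_eq by auto
  moreover have "sigma_algebra UNIV (lambda_system UNIV UNIV (hausdorff_measure s :: 'a set \<Rightarrow> _))"
    using P.caratheodory_lemma[OF outer_measure_space_hausdorff] by (simp add: measure_space_def)
  ultimately show ?thesis
    unfolding borel_eq_closed by (simp add: sigma_algebra.sigma_sets_subset)
qed

lemma emeasure_hausdorff_borel:
  fixes A :: "'a::metric_space set"
  assumes "A \<in> sets borel"
  shows "emeasure (hausdorff_borel s) A = hausdorff_measure s A"
  unfolding hausdorff_borel_def
proof (rule emeasure_measure_of_sigma[OF _ _ _ assms])
  interpret P: sigma_algebra UNIV "UNIV :: 'a set set"
    using sigma_algebra_Pow[of UNIV] by simp
  have "measure_space UNIV (lambda_system UNIV UNIV (hausdorff_measure s)) (hausdorff_measure s :: 'a set \<Rightarrow> _)"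
    by (rule P.caratheodory_lemma[OF outer_measure_space_hausdorff])
  then show "positive (sets borel) (hausdorff_measure s :: 'a set \<Rightarrow> _)"
    "countably_additive (sets borel) (hausdorff_measure s :: 'a set \<Rightarrow> _)"
    using borel_subset_lambda_system[where 'a='a, of s]
    unfolding measure_space_def positive_def countably_additive_def by blast+
  show "sigma_algebra UNIV (sets (borel :: 'a measure))"
    using sets.sigma_algebra_axioms[of "borel :: 'a measure"] by simp
qed

section \<open>Separated nets and packing dimension\<close>

text \<open>Cover \<open>K\<close> by finitely many balls of radius \<open>e / 2\<close>. Each holds
  at most one point of an \<open>e\<close>-separated set, which bounds the cardinality of such sets.
  One of greatest cardinality cannot be enlarged, so its \<open>e\<close>-balls cover
  \<open>E\<close>; the set \<open>E\<close> itself may be any subset of \<open>K\<close>.\<close>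

lemma compact_separated_net:
  fixes K :: "'a::metric_space set"
  assumes "compact K" "E \<subseteq> K" "0 < e"
  obtains S where "finite S" "S \<subseteq> E" "\<And>x y. x \<in> S \<Longrightarrow> y \<in> S \<Longrightarrow> x \<noteq> y \<Longrightarrow> e \<le> dist x y"
    "E \<subseteq> (\<Union>x\<in>S. ball x e)"
proof -
  obtain T where T: "finite T" "K \<subseteq> (\<Union>x\<in>T. ball x (e / 2))"
    using assms by (metis compact_eq_totally_bounded half_gt_zero)
  define P where "P S \<longleftrightarrow> finite S \<and> S \<subseteq> E \<and> (\<forall>x\<in>S. \<forall>y\<in>S. x \<noteq> y \<longrightarrow> e \<le> dist x y)" for S
  have bound: "card S \<le> card T" if "P S" for S
  proof -
    have "S \<subseteq> (\<Union>x\<in>T. ball x (e / 2))" using that T(2) assms(2) unfolding P_def by blast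
    then have "\<forall>x\<in>S. \<exists>y\<in>T. x \<in> ball y (e / 2)" by blast
    then obtain f where f: "\<And>x. x \<in> S \<Longrightarrow> f x \<in> T \<and> x \<in> ball (f x) (e / 2)" by metis
    have "inj_on f S"
    proof (rule inj_onI, rule ccontr)
      fix x y assume xy: "x \<in> S" "y \<in> S" "f x = f y" "x \<noteq> y"
      then have "e \<le> dist x y" using that by (auto simp: P_def)
      moreover have "dist (f x) x < e / 2" "dist (f x) y < e / 2"
        using f[OF xy(1)] f[OF xy(2)] unfolding xy(3) mem_ball by blast+
      then have "dist x y < e" by (rule dist_triangle_half_r)
      ultimately show False by simp
    qed
    moreover have "f ` S \<subseteq> T" using f by blast
    ultimately show ?thesis using T(1) by (rule card_inj_on_le)
  qed
  have "\<exists>S. P S \<and> (\<forall>S'. P S' \<longrightarrow> card S' \<le> card S)"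
    by (rule ex_has_greatest_nat[of P "{}" card "Suc (card T)"]) (use bound in \<open>auto simp: P_def less_Suc_eq_le\<close>)
  then obtain S where S: "P S" "\<And>S'. P S' \<Longrightarrow> card S' \<le> card S" by metis
  have "E \<subseteq> (\<Union>x\<in>S. ball x e)"
  proof (rule ccontr)
    assume "\<not> ?thesis"
    then obtain x where x: "x \<in> E" "\<And>y. y \<in> S \<Longrightarrow> e \<le> dist y x" by force
    have "P (insert x S)"
      using S(1) x by (auto simp: P_def dist_commute)
    moreover have "x \<notin> S" using x(2)[of x] \<open>0 < e\<close> by auto
    ultimately show False using S(1) S(2)[of "insert x S"] by (simp add: P_def)
  qed
  then show ?thesis using that[of S] S(1) by (auto simp: P_def)
qed

text \<open>Padding a finite cover with empty sets, which cost nothing, gives the sequence that the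
  definition asks for.\<close>

lemma hausdorff_premeasure_le_sum:
  assumes "finite S" "A \<subseteq> (\<Union>x\<in>S. U x)" "\<And>x. x \<in> S \<Longrightarrow> bounded (U x)"
    "\<And>x. x \<in> S \<Longrightarrow> diameter (U x) \<le> \<delta>" "0 \<le> \<delta>"
  shows "hausdorff_premeasure s \<delta> A \<le> (\<Sum>x\<in>S. diam_pow s (U x))"
proof -
  obtain f where f: "bij_betw f {..<card S} S"
    using assms(1) ex_bij_betw_nat_finite by (metis atLeast0LessThan)
  define V where "V i = (if i < card S then U (f i) else {})" for i
  have fS: "f i \<in> S" if "i < card S" for i using f that by (auto simp: bij_betw_def)
  have "hausdorff_premeasure s \<delta> A \<le> (\<Sum>i. diam_pow s (V i))"
  proof (rule hausdorff_premeasure_le)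
    show "A \<subseteq> (\<Union>i. V i)"
    proof
      fix a assume "a \<in> A"
      then obtain x where "x \<in> S" "a \<in> U x" using assms(2) by blast
      moreover from this obtain i where "i < card S" "x = f i"
        using bij_betw_imp_surj_on[OF f] by auto
      ultimately have "i < card S" "a \<in> U (f i)" by auto
      then have "a \<in> V i" by (simp add: V_def)
      then show "a \<in> (\<Union>i. V i)" by blast
    qed
  qed (use assms(3-5) fS in \<open>auto simp: V_def\<close>)
  also have "\<dots> = (\<Sum>i<card S. diam_pow s (V i))"
    by (rule suminf_finite) (auto simp: V_def)
  also have "\<dots> = (\<Sum>i<card S. diam_pow s (U (f i)))"
    by (rule sum.cong) (auto simp: V_def)
  also have "\<dots> = (\<Sum>x\<in>S. diam_pow s (U x))"
    by (rule sum.reindex_bij_betw[OF f])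
  finally show ?thesis .
qed

lemma diameter_ball_le:
  fixes x :: "'a::metric_space"
  assumes "0 \<le> e"
  shows "diameter (ball x e) \<le> 2 * e"
  unfolding diameter_def using assms
  by (auto intro!: cSUP_least order_trans[OF dist_triangle3[of _ _ x]])

text \<open>Packings use closed balls, and closed balls of radius \<open>e / 2\<close> could still
  touch; one third of the separation leaves room.\<close>

lemma disjoint_cball_third:
  fixes x y :: "'a::metric_space"
  assumes "0 < e" "e \<le> dist x y"
  shows "cball x (e / 3) \<inter> cball y (e / 3) = {}"
proof (rule ccontr)
  assume "\<not> ?thesis"
  then obtain z where "dist x z \<le> e / 3" "dist y z \<le> e / 3" by auto
  then show False using assms dist_triangle2[of x y z] by simp
qed

section \<open>Comparison of Hausdorff and packing measures\<close>

lemma packing_premeasure_mono: "A \<subseteq> B \<Longrightarrow> packing_premeasure t A \<le> packing_premeasure t B"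
  unfolding packing_premeasure_def
  by (intro INF_mono' SUP_subset_mono) (auto simp: packings_def)

text \<open>A maximal \<open>e\<close>-separated set gives a packing by balls of radius \<open>e/3\<close>, whose concentric balls of
  radius \<open>e\<close> cover.\<close>

lemma hausdorff_le_packing_premeasure:
  fixes K :: "'a::metric_space set"
  assumes "compact K" "E \<subseteq> K" "0 \<le> t"
  shows "ennreal ((1/3) powr t) * hausdorff_measure t E \<le> packing_premeasure t E"
proof -
  have "ennreal ((1/3) powr t) * hausdorff_premeasure t \<delta> E
      \<le> (SUP F \<in> packings \<eta> E. \<Sum>\<^sub>\<infinity>(x, r)\<in>F. ennreal ((2 * r) powr t))"
    if "0 < \<delta>" "0 < \<eta>" for \<delta> \<eta>
  proof -
    \<comment> \<open>One scale serves both purposes: covering balls of radius \<open>e\<close> have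
      diameter at most \<open>\<delta>\<close>, and packing balls of radius \<open>e / 3\<close> are
      admissible for \<open>\<eta>\<close>.\<close>
    define e where "e = min (\<delta> / 2) \<eta>"
    have e: "0 < e" "2 * e \<le> \<delta>" "e \<le> \<eta>" using that by (auto simp: e_def)
    obtain S where S: "finite S" "S \<subseteq> E"
        "\<And>x y. x \<in> S \<Longrightarrow> y \<in> S \<Longrightarrow> x \<noteq> y \<Longrightarrow> e \<le> dist x y" "E \<subseteq> (\<Union>x\<in>S. ball x e)"
      using compact_separated_net[OF assms(1,2) e(1)] by metis
    define F where "F = (\<lambda>x. (x, e / 3)) ` S"
    have disj: "cball x (e / 3) \<inter> cball y (e / 3) = {}" if "x \<in> S" "y \<in> S" "x \<noteq> y" for x y
      by (rule disjoint_cball_third[OF e(1) S(3)[OF that]])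
    have F: "F \<in> packings \<eta> E"
      using S(1,2) e disj by (auto simp: packings_def F_def disjoint_family_on_def countable_finite)
    have "ennreal ((1/3) powr t) * hausdorff_premeasure t \<delta> E
        \<le> ennreal ((1/3) powr t) * (\<Sum>x\<in>S. diam_pow t (ball x e))"
      using e S order_trans[OF diameter_ball_le e(2)]
      by (intro mult_left_mono hausdorff_premeasure_le_sum) auto
    also have "\<dots> \<le> ennreal ((1/3) powr t) * (\<Sum>x\<in>S. ennreal ((2 * e) powr t))"
      using e assms(3) by (intro mult_left_mono sum_mono diam_pow_le diameter_ball_le) auto
    also have "\<dots> = (\<Sum>x\<in>S. ennreal ((2 * (e / 3)) powr t))"
      using e by (simp add: sum_distrib_left ennreal_mult[symmetric] powr_mult[symmetric] mult.left_commute)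
    also have "\<dots> = (\<Sum>\<^sub>\<infinity>(x, r)\<in>F. ennreal ((2 * r) powr t))"
      using S(1) by (subst infsum_finite) (auto simp: F_def sum.reindex inj_on_def)
    also have "\<dots> \<le> (SUP F \<in> packings \<eta> E. \<Sum>\<^sub>\<infinity>(x, r)\<in>F. ennreal ((2 * r) powr t))"
      using F by (rule SUP_upper)
    finally show ?thesis .
  qed
  then show ?thesis
    unfolding hausdorff_measure_def packing_premeasure_def
    unfolding SUP_mult_left_ennreal by (intro SUP_least INF_greatest) auto
qed

text \<open>The comparison with the premeasure is applied to each piece of a cover, and countable
  subadditivity of the Hausdorff measure adds up the results. The pieces are cut down to
  \<open>K\<close>, because separated nets are available only inside a compact set.\<close>

lemma hausdorff_le_packing_measure:
  fixes K :: "'a::metric_space set"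
  assumes "compact K" "0 \<le> t"
  shows "ennreal ((1/3) powr t) * hausdorff_measure t K \<le> packing_measure t K"
  unfolding packing_measure_def
proof (intro INF_greatest)
  fix E :: "nat \<Rightarrow> 'a set" assume "E \<in> {E. K \<subseteq> (\<Union>i. E i)}"
  then have "K \<subseteq> (\<Union>i. E i \<inter> K)" by auto
  then have "hausdorff_measure t K \<le> (\<Sum>i. hausdorff_measure t (E i \<inter> K))"
    by (rule order_trans[OF hausdorff_measure_mono hausdorff_measure_UN_le])
  then have "ennreal ((1/3) powr t) * hausdorff_measure t K
      \<le> ennreal ((1/3) powr t) * (\<Sum>i. hausdorff_measure t (E i \<inter> K))"
    by (rule mult_left_mono) simp
  also have "\<dots> = (\<Sum>i. ennreal ((1/3) powr t) * hausdorff_measure t (E i \<inter> K))"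
    by (rule ennreal_suminf_cmult[symmetric])
  also have "\<dots> \<le> (\<Sum>i. packing_premeasure t (E i))"
  proof (intro suminf_le summableI)
    fix i
    show "ennreal ((1/3) powr t) * hausdorff_measure t (E i \<inter> K) \<le> packing_premeasure t (E i)"
      using hausdorff_le_packing_premeasure[OF assms(1) Int_lower2 assms(2)]
        packing_premeasure_mono[OF Int_lower1] by (rule order_trans)
  qed
  finally show "ennreal ((1/3) powr t) * hausdorff_measure t K \<le> (\<Sum>i. packing_premeasure t (E i))" .
qed

lemma hausdorff_dim_le_packing_dim:
  fixes K :: "'a::metric_space set"
  assumes "compact K"
  shows "hausdorff_dim K \<le> packing_dim K"
  unfolding hausdorff_dim_def packing_dim_def
proof (intro Inf_superset_mono subsetI)
  fix z assume "z \<in> {ereal s |s. 0 \<le> s \<and> packing_measure s K = 0}"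
  then obtain s where s: "z = ereal s" "0 \<le> s" "packing_measure s K = 0" by auto
  then have "hausdorff_measure s K = 0"
    using hausdorff_le_packing_measure[OF assms s(2)] by simp
  then show "z \<in> {ereal s |s. 0 \<le> s \<and> hausdorff_measure s K = 0}" using s by auto
qed

lemma packing_premeasure_empty [simp]: "packing_premeasure t {} = 0"
proof -
  have "packings \<delta> ({} :: 'a set) = {{}}" for \<delta>
    by (auto simp: packings_def disjoint_family_on_def)
  then show ?thesis by (simp add: packing_premeasure_def)
qed

lemma packing_measure_le_premeasure: "packing_measure t A \<le> packing_premeasure t A"
proof -
  have "packing_measure t A \<le> (\<Sum>i. packing_premeasure t (if i = 0 then A else {}))"
    unfolding packing_measure_def by (rule INF_lower) auto
  also have "\<dots> = packing_premeasure t A"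
    by (subst suminf_finite[of "{0}"]) auto
  finally show ?thesis .
qed

section \<open>Upper bound for the packing dimension of an Ahlfors regular set\<close>

locale ahlfors_compact =
  fixes K :: "'a::metric_space set" and s c1 c2 r0 :: real
  assumes compact: "compact K"
    and s_pos: "0 < s" and c1_pos: "0 < c1" and c2_pos: "0 < c2" and r0_pos: "0 < r0"
    and lower: "\<And>x r. x \<in> K \<Longrightarrow> 0 < r \<Longrightarrow> r < r0 \<Longrightarrow> ennreal (c1 * r powr s) \<le> hausdorff_measure s (K \<inter> ball x r)"
    and upper: "\<And>x r. x \<in> K \<Longrightarrow> 0 < r \<Longrightarrow> r < r0 \<Longrightarrow> hausdorff_measure s (K \<inter> ball x r) \<le> ennreal (c2 * r powr s)"
begin

lemma borel_K [simp, measurable]: "K \<in> sets borel"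
  by (intro borel_closed compact_imp_closed compact)

lemma emeasure_ball: "emeasure (hausdorff_borel s) (K \<inter> ball x r) = hausdorff_measure s (K \<inter> ball x r)"
  by (rule emeasure_hausdorff_borel) auto

text \<open>Finitely many balls of radius \<open>r0 / 2\<close> cover \<open>K\<close>; halving
  \<open>r0\<close> meets the strict bound on the radius in the regularity estimate.\<close>

lemma hausdorff_finite: "hausdorff_measure s K < \<top>"
proof -
  obtain S where S: "finite S" "S \<subseteq> K" "K \<subseteq> (\<Union>x\<in>S. ball x (r0 / 2))"
    using compact_separated_net[OF compact order_refl, of "r0 / 2"] r0_pos by (metis half_gt_zero)
  have "hausdorff_measure s K = emeasure (hausdorff_borel s) (\<Union>x\<in>S. K \<inter> ball x (r0 / 2))"
    using S(3) by (subst emeasure_hausdorff_borel[symmetric]) (auto intro!: arg_cong2[where f=emeasure])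
  also have "\<dots> \<le> (\<Sum>x\<in>S. emeasure (hausdorff_borel s) (K \<inter> ball x (r0 / 2)))"
    using S(1) by (intro emeasure_subadditive_finite) auto
  also have "\<dots> \<le> (\<Sum>x\<in>S. ennreal (c2 * (r0 / 2) powr s))"
    using S(2) r0_pos by (intro sum_mono) (auto simp: emeasure_ball intro!: upper)
  also have "\<dots> < \<top>" by (simp add: of_nat_less_top ennreal_mult_less_top)
  finally show ?thesis .
qed

text \<open>Each ball of the packing has Hausdorff measure at least \<open>c1 * r powr s\<close>
  inside \<open>K\<close>, and disjointness lets these masses add up inside
  \<open>K\<close>.\<close>

lemma packing_sum_le:
  assumes "finite F" "\<And>x r. (x, r) \<in> F \<Longrightarrow> x \<in> K \<and> 0 < r \<and> r < r0"
    and "disjoint_family_on (\<lambda>(x, r). cball x r) F"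
  shows "(\<Sum>(x, r)\<in>F. ennreal (c1 * r powr s)) \<le> hausdorff_measure s K"
proof -
  have "(\<Sum>(x, r)\<in>F. ennreal (c1 * r powr s))
      \<le> (\<Sum>p\<in>F. emeasure (hausdorff_borel s) (K \<inter> ball (fst p) (snd p)))"
  proof (rule sum_mono)
    fix p assume "p \<in> F"
    moreover obtain x r where "p = (x, r)" by (cases p)
    ultimately show "(case p of (x, r) \<Rightarrow> ennreal (c1 * r powr s))
        \<le> emeasure (hausdorff_borel s) (K \<inter> ball (fst p) (snd p))"
      using assms(2)[of x r] lower[of x r] by (simp add: emeasure_ball)
  qed
  also have "\<dots> = emeasure (hausdorff_borel s) (\<Union>p\<in>F. K \<inter> ball (fst p) (snd p))"
  proof (rule sum_emeasure)
    show "disjoint_family_on (\<lambda>p. K \<inter> ball (fst p) (snd p)) F"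
      unfolding disjoint_family_on_def
    proof (intro ballI impI)
      fix p q assume "p \<in> F" "q \<in> F" "p \<noteq> q"
      then have "cball (fst p) (snd p) \<inter> cball (fst q) (snd q) = {}"
        using assms(3) by (simp add: disjoint_family_on_def case_prod_beta)
      then show "(K \<inter> ball (fst p) (snd p)) \<inter> (K \<inter> ball (fst q) (snd q)) = {}"
        using ball_subset_cball by blast
    qed
  qed (use assms(1) in auto)
  also have "\<dots> \<le> emeasure (hausdorff_borel s) K"
    by (intro emeasure_mono) auto
  also have "\<dots> = hausdorff_measure s K" by (simp add: emeasure_hausdorff_borel)
  finally show ?thesis .
qed

text \<open>For \<open>r \<le> \<delta>\<close>, the term \<open>(2r)^t\<close> is at most
  \<open>2^t \<delta>^(t-s) r^s\<close>. The sum of the \<open>r^s\<close> over a packing is bounded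
  independently of \<open>\<delta>\<close>, so letting \<open>\<delta>\<close> tend to 0 leaves
  nothing.\<close>

lemma packing_premeasure_eq_0:
  assumes "s < t"
  shows "packing_premeasure t K = 0"
proof -
  obtain h where h: "0 \<le> h" "hausdorff_measure s K = ennreal h"
    using hausdorff_finite by (cases "hausdorff_measure s K") auto
  define C where "C = 2 powr t / c1 * h"
  have "0 \<le> C" using h c1_pos by (simp add: C_def)
  have bound: "(\<Sum>\<^sub>\<infinity>(x, r)\<in>F. ennreal ((2 * r) powr t)) \<le> ennreal (C * \<delta> powr (t - s))"
    if \<delta>: "0 < \<delta>" "\<delta> < r0" and F: "F \<in> packings \<delta> K" for \<delta> F
  \<comment> \<open>The mass count is for finite packings; a sum of nonnegative terms is controlled
    by its finite subsums.\<close>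
  proof (rule infsum_le_finite_sums)
    fix F' assume F': "finite F'" "F' \<subseteq> F"
    have *: "x \<in> K \<and> 0 < r \<and> r \<le> \<delta>" if "(x, r) \<in> F'" for x r
      using F F' that by (auto simp: packings_def)
    have "(\<Sum>(x, r)\<in>F'. ennreal ((2 * r) powr t))
        \<le> (\<Sum>p\<in>F'. ennreal (2 powr t / c1 * \<delta> powr (t - s)) * ennreal (c1 * snd p powr s))"
    proof (rule sum_mono, clarsimp)
      fix x r assume "(x, r) \<in> F'"
      then have r: "0 < r" "r \<le> \<delta>" using * by auto
      have "(2 * r) powr t = 2 powr t * (r powr (t - s) * r powr s)"
        using r by (simp add: powr_mult powr_add[symmetric])
      also have "\<dots> \<le> 2 powr t * (\<delta> powr (t - s) * r powr s)"
        using r assms by (intro mult_left_mono mult_right_mono powr_mono2) auto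
      also have "\<dots> = 2 powr t / c1 * \<delta> powr (t - s) * (c1 * r powr s)"
        using c1_pos by simp
      finally show "ennreal ((2 * r) powr t)
          \<le> ennreal (2 powr t * \<delta> powr (t - s) / c1) * ennreal (c1 * r powr s)"
        using c1_pos by (simp add: ennreal_mult[symmetric] ennreal_leI)
    qed
    also have "\<dots> = ennreal (2 powr t / c1 * \<delta> powr (t - s)) * (\<Sum>(x, r)\<in>F'. ennreal (c1 * r powr s))"
      by (simp add: sum_distrib_left case_prod_beta)
    also have "\<dots> \<le> ennreal (2 powr t / c1 * \<delta> powr (t - s)) * hausdorff_measure s K"
    proof (intro mult_left_mono packing_sum_le F')
      show "disjoint_family_on (\<lambda>(x, r). cball x r) F'"
        using F F'(2) disjoint_family_on_mono by (fastforce simp: packings_def)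
    qed (use * \<delta> in \<open>fastforce+\<close>)
    also have "\<dots> = ennreal (C * \<delta> powr (t - s))"
      using h c1_pos by (simp add: C_def ennreal_mult[symmetric] mult_ac)
    finally show "(\<Sum>(x, r)\<in>F'. ennreal ((2 * r) powr t)) \<le> ennreal (C * \<delta> powr (t - s))" .
  qed (rule nonneg_summable_on_complete, simp)
  have "packing_premeasure t K \<le> ennreal (C * \<delta> powr (t - s))" if "0 < \<delta>" "\<delta> < r0" for \<delta>
    unfolding packing_premeasure_def using bound[OF that] that
    by (intro INF_lower2[of \<delta>] SUP_least) auto
  then have "\<forall>\<^sub>F \<delta> in at_right 0. packing_premeasure t K \<le> ennreal (C * \<delta> powr (t - s))"
    using r0_pos by (auto simp: eventually_at_right_field)
  moreover have "((\<lambda>\<delta>. C * \<delta> powr (t - s)) \<longlongrightarrow> C * 0) (at_right 0)"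
    using assms by (intro tendsto_mult tendsto_const tendsto_zero_powrI[where b="t - s"])
      (auto simp: eventually_at_right_field intro: tendsto_ident_at gt_ex)
  then have "((\<lambda>\<delta>. ennreal (C * \<delta> powr (t - s))) \<longlongrightarrow> ennreal 0) (at_right 0)"
    by (intro tendsto_ennrealI) simp
  ultimately have "packing_premeasure t K \<le> ennreal 0"
    using trivial_limit_at_right_real by (metis tendsto_lowerbound)
  then show ?thesis by simp
qed

lemma packing_dim_le: "packing_dim K \<le> ereal s"
proof (rule ereal_le_epsilon2)
  fix e :: real assume "0 < e"
  then have "packing_measure (s + e) K = 0"
    using packing_premeasure_eq_0[of "s + e"] packing_measure_le_premeasure[of "s + e" K] by simp
  then show "packing_dim K \<le> ereal s + ereal e"
    unfolding packing_dim_def using s_pos \<open>0 < e\<close>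
    by (intro Inf_lower) (auto intro!: exI[of _ "s + e"])
qed

end

section \<open>Upper local dimension\<close>

text \<open>Taking logarithms preserves the bound on \<open>p\<close>, and dividing by the negative
  number \<open>ln r\<close> reverses it.\<close>

lemma local_ratio_le:
  assumes "0 < r" "r < 1" "r powr t \<le> p"
  shows "ln_ereal p / ereal (ln r) \<le> ereal t"
proof -
  have "0 < p" using assms(1,3) powr_gt_zero[of r t] by linarith
  then have "t * ln r \<le> ln p" using assms by (metis ln_le_cancel_iff ln_powr powr_gt_zero less_irrefl)
  moreover have "ln r < 0" using assms by simp
  ultimately have "ln p / ln r \<le> t" by (simp add: neg_divide_le_eq)
  then show ?thesis using \<open>0 < p\<close> \<open>ln r < 0\<close> by (simp add: ln_ereal_def)
qed

lemma local_ratio_ge: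
  assumes "0 < r" "r < 1" "0 \<le> p" "p \<le> r powr t"
  shows "ereal t \<le> ln_ereal p / ereal (ln r)"
proof (cases "p = 0")
  \<comment> \<open>The quotient of \<open>- \<infinity>\<close> by the negative number
    \<open>ln r\<close> is \<open>+ \<infinity>\<close>.\<close>
  case True
  then show ?thesis using assms by (simp add: ln_ereal_def divide_ereal_def)
next
  case False
  then have "ln p \<le> t * ln r" using assms by (metis ln_le_cancel_iff ln_powr order_le_less less_le_trans)
  moreover have "ln r < 0" using assms by simp
  ultimately have "t \<le> ln p / ln r" by (simp add: neg_le_divide_eq)
  then show ?thesis using False \<open>ln r < 0\<close> by (simp add: ln_ereal_def)
qed

lemma borel_prob_measuresD:
  assumes "\<mu> \<in> borel_prob_measures K"
  shows "prob_space \<mu>" "sets \<mu> = sets (restrict_space borel K)" "space \<mu> = K"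
  using assms sets_eq_imp_space_eq[of \<mu> "restrict_space borel K"]
  by (auto simp: borel_prob_measures_def space_restrict_space)

lemma sets_borel_prob_measure:
  assumes "\<mu> \<in> borel_prob_measures K" "A \<in> sets borel"
  shows "K \<inter> A \<in> sets \<mu>" "A \<inter> K \<in> sets \<mu>"
  using assms(2) unfolding borel_prob_measuresD(2)[OF assms(1)] sets_restrict_space by (auto simp: Int_commute)

section \<open>Almost everywhere upper bound for the local dimension\<close>

context ahlfors_compact
begin

text \<open>The balls of radius \<open>e / 3\<close> about the points form a packing, so the number
  of points is at most of order \<open>e^(-s)\<close>.\<close>

lemma card_separated_le:
  assumes "finite S" "S \<subseteq> K" "\<And>x y. x \<in> S \<Longrightarrow> y \<in> S \<Longrightarrow> x \<noteq> y \<Longrightarrow> e \<le> dist x y" "0 < e" "e < r0"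
  shows "real (card S) * (c1 * (e / 3) powr s) \<le> enn2real (hausdorff_measure s K)"
proof -
  define F where "F = (\<lambda>x. (x, e / 3)) ` S"
  have disj: "cball x (e / 3) \<inter> cball y (e / 3) = {}" if "x \<in> S" "y \<in> S" "x \<noteq> y" for x y
    by (rule disjoint_cball_third[OF assms(4) assms(3)[OF that]])
  have "ennreal (real (card S) * (c1 * (e / 3) powr s)) = (\<Sum>(x, r)\<in>F. ennreal (c1 * r powr s))"
    using c1_pos by (simp add: F_def sum.reindex inj_on_def ennreal_mult ennreal_of_nat_eq_real_of_nat)
  also have "\<dots> \<le> hausdorff_measure s K"
    by (rule packing_sum_le) (use assms disj in \<open>auto simp: F_def disjoint_family_on_def\<close>)
  also have "\<dots> = ennreal (enn2real (hausdorff_measure s K))"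
    using hausdorff_finite by (simp add: less_top)
  finally show ?thesis by (simp add: ennreal_le_iff)
qed

text \<open>At scale \<open>\<rho>\<close>, the points whose ball has mass below
  \<open>(2\<rho>)^t\<close> are covered by order \<open>\<rho>^(-s)\<close> such balls, hence by a
  set of mass of order \<open>\<rho>^(t-s)\<close>. Along dyadic scales this is summable, and
  Borel-Cantelli applies.\<close>

lemma AE_upper_local_dim_less:
  assumes \<mu>: "\<mu> \<in> borel_prob_measures K" and t: "s < t"
  shows "AE x in \<mu>. upper_local_dim \<mu> x \<le> ereal t"
proof -
  interpret prob_space \<mu> using \<mu> by (rule borel_prob_measuresD)
  have [simp]: "space \<mu> = K" using \<mu> by (rule borel_prob_measuresD)
  have [simp]: "ball x r \<inter> K \<in> sets \<mu>" for x r
    by (rule sets_borel_prob_measure[OF \<mu>]) auto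
  \<comment> \<open>The scales start at \<open>r0 / 2\<close>, so that every one of them lies below
    \<open>r0\<close>.\<close>
  define \<rho> where "\<rho> n = r0 * (1/2) ^ Suc n" for n
  have \<rho>: "0 < \<rho> n" "\<rho> n < r0" "2 * \<rho> (Suc n) = \<rho> n" for n
    using r0_pos power_Suc_less_one[of "1/2 :: real" n] by (auto simp: \<rho>_def)
  have \<rho>_mono: "\<rho> n \<le> \<rho> m" if "m \<le> n" for m n
    using that r0_pos by (simp add: \<rho>_def power_decreasing)
  \<comment> \<open>The factor 2 turns \<open>\<rho> n\<close> into the preceding scale; it is used
    to pass from dyadic radii to all radii.\<close>
  define A where "A n = {x \<in> K. measure \<mu> (ball x (\<rho> n) \<inter> K) < (2 * \<rho> n) powr t}" for n
  have "\<exists>S. finite S \<and> S \<subseteq> A n \<and> (\<forall>x\<in>S. \<forall>y\<in>S. x \<noteq> y \<longrightarrow> \<rho> n \<le> dist x y) \<and> A n \<subseteq> (\<Union>x\<in>S. ball x (\<rho> n))" for n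
  proof -
    have "A n \<subseteq> K" by (auto simp: A_def)
    then show ?thesis using compact_separated_net[OF compact _ \<rho>(1)[of n]] by metis
  qed
  then obtain S where S: "\<And>n. finite (S n)" "\<And>n. S n \<subseteq> A n"
    "\<And>n x y. x \<in> S n \<Longrightarrow> y \<in> S n \<Longrightarrow> x \<noteq> y \<Longrightarrow> \<rho> n \<le> dist x y" "\<And>n. A n \<subseteq> (\<Union>x\<in>S n. ball x (\<rho> n))"
    by metis
  \<comment> \<open>A measurable superset of \<open>A n\<close>, to which Borel-Cantelli is
    applied.\<close>
  define B where "B n = (\<Union>x\<in>S n. ball x (\<rho> n) \<inter> K)" for n
  define h where "h = enn2real (hausdorff_measure s K)"
  \<comment> \<open>The count of net points gives \<open>h / c1 * 3 powr s\<close>, the factor 2 in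
    \<open>A n\<close> gives \<open>2 powr t\<close>, and the rest comes from
    \<open>\<rho> n = (r0/2) (1/2)^n\<close>.\<close>
  define C where "C = h / c1 * 3 powr s * 2 powr t * (r0 / 2) powr (t - s)"
  have AB: "A n \<subseteq> B n" for n using S(4)[of n] by (auto simp: A_def B_def)
  have B_sets: "B n \<in> sets \<mu>" for n
    unfolding B_def using S(1) by (intro sets.finite_UN) auto
  have B_le: "measure \<mu> (B n) \<le> C * ((1/2) powr (t - s)) ^ n" for n
  proof -
    have SK: "S n \<subseteq> K" using S(2)[of n] by (auto simp: A_def)
    have card: "real (card (S n)) \<le> h / (c1 * (\<rho> n / 3) powr s)"
      using card_separated_le[OF S(1) SK S(3) \<rho>(1,2)] c1_pos \<rho>(1)[of n] by (simp add: h_def le_divide_eq)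
    have "measure \<mu> (B n) \<le> (\<Sum>x\<in>S n. measure \<mu> (ball x (\<rho> n) \<inter> K))"
      unfolding B_def using S(1) by (intro finite_measure_subadditive_finite) auto
    also have "\<dots> \<le> (\<Sum>x\<in>S n. (2 * \<rho> n) powr t)"
      using S(2)[of n] by (intro sum_mono) (auto simp: A_def intro: less_imp_le)
    also have "\<dots> = real (card (S n)) * (2 * \<rho> n) powr t" by simp
    also have "\<dots> \<le> h / (c1 * (\<rho> n / 3) powr s) * (2 * \<rho> n) powr t"
      using card by (intro mult_right_mono) auto
    also have "\<dots> = h / c1 * 3 powr s * 2 powr t * \<rho> n powr (t - s)"
      using \<rho>(1)[of n] by (simp add: powr_mult powr_divide powr_diff)
    also have "\<rho> n powr (t - s) = (r0 / 2) powr (t - s) * ((1/2) powr (t - s)) ^ n"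
    proof -
      have "\<rho> n = (r0 / 2) * (1/2) powr real n"
        by (simp add: \<rho>_def powr_realpow)
      then have "\<rho> n powr (t - s) = (r0 / 2) powr (t - s) * ((1/2) powr real n) powr (t - s)"
        using r0_pos by (simp only: powr_mult)
      also have "((1/2 :: real) powr real n) powr (t - s) = ((1/2) powr (t - s)) ^ n"
        by (simp add: powr_powr mult.commute powr_realpow[symmetric])
      finally show ?thesis .
    qed
    finally show ?thesis by (simp add: C_def mult_ac)
  qed
  have "(1/2 :: real) powr (t - s) < 1" using t powr_less_mono2[of "t - s" "1/2" 1] by simp
  then have "summable (\<lambda>n. C * ((1/2) powr (t - s)) ^ n)"
    by (intro summable_mult summable_geometric) auto
  then have "summable (\<lambda>n. measure \<mu> (B n))"
    by (rule summable_comparison_test') (use B_le in auto)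
  then have "AE x in \<mu>. \<forall>\<^sub>F n in sequentially. x \<in> space \<mu> - B n"
    using B_sets by (intro borel_cantelli_AE1) (auto simp: emeasure_eq_measure)
  then show ?thesis
  proof eventually_elim
    fix x assume "\<forall>\<^sub>F n in sequentially. x \<in> space \<mu> - B n"
    then obtain N where N: "\<And>n. N \<le> n \<Longrightarrow> x \<in> K - B n"
      by (auto simp: eventually_sequentially)
    then have large: "(2 * \<rho> n) powr t \<le> measure \<mu> (ball x (\<rho> n) \<inter> K)" if "N \<le> n" for n
      using N[OF that] AB[of n] by (auto simp: A_def not_less)
    have "ln_ereal (measure \<mu> (ball x r \<inter> K)) / ereal (ln r) \<le> ereal t"
      if r: "0 < r" "r < min 1 (\<rho> N)" for r
    proof (rule local_ratio_le)
      have "\<rho> \<longlonglongrightarrow> r0 * 0"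
        unfolding \<rho>_def by (intro tendsto_mult tendsto_const LIMSEQ_Suc LIMSEQ_realpow_zero) auto
      then have "\<forall>\<^sub>F n in sequentially. \<rho> n < r" using r(1) by (intro order_tendstoD) auto
      then obtain m where m: "\<rho> m < r" by (auto simp: eventually_sequentially)
      \<comment> \<open>For the first scale below \<open>r\<close>, the ball of radius
        \<open>\<rho> n\<close> lies in the ball of radius \<open>r\<close>, while \<open>r\<close>
        is at most the preceding scale \<open>2 * \<rho> n\<close>.\<close>
      define n where "n = (LEAST n. \<rho> n < r)"
      have n: "\<rho> n < r" unfolding n_def using m by (rule LeastI)
      have "N < n" using \<rho>_mono[of n N] n r by (cases "n \<le> N") auto
      then obtain k where k: "n = Suc k" "N \<le> k" by (cases n) auto
      have "r \<le> \<rho> k" using not_less_Least[of k "\<lambda>n. \<rho> n < r"] k by (simp add: n_def)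
      then have "r powr t \<le> (2 * \<rho> n) powr t"
        using r(1) t s_pos \<rho>(3)[of k] k by (intro powr_mono2) auto
      also have "\<dots> \<le> measure \<mu> (ball x (\<rho> n) \<inter> K)" using k by (intro large) auto
      also have "\<dots> \<le> measure \<mu> (ball x r \<inter> K)"
        using n by (intro finite_measure_mono) auto
      finally show "r powr t \<le> measure \<mu> (ball x r \<inter> K)" .
    qed (use r in auto)
    then have "\<forall>\<^sub>F r in at_right 0. ln_ereal (measure \<mu> (ball x r \<inter> K)) / ereal (ln r) \<le> ereal t"
      unfolding eventually_at_right_field using \<rho>(1)[of N] by (intro exI[of _ "min 1 (\<rho> N)"]) auto
    then show "upper_local_dim \<mu> x \<le> ereal t"
      unfolding upper_local_dim_def by (simp add: Limsup_bounded)
  qed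
qed

text \<open>The exceptional null set depends on the exponent; only countably many exponents
  decreasing to \<open>s\<close> are needed.\<close>

lemma AE_upper_local_dim_le:
  assumes "\<mu> \<in> borel_prob_measures K"
  shows "AE x in \<mu>. upper_local_dim \<mu> x \<le> ereal s"
proof -
  have "AE x in \<mu>. \<forall>n. upper_local_dim \<mu> x \<le> ereal (s + 1 / real (Suc n))"
    by (intro AE_all_countable[THEN iffD2] allI AE_upper_local_dim_less[OF assms]) simp
  then show ?thesis
  proof eventually_elim
    fix x assume *: "\<forall>n. upper_local_dim \<mu> x \<le> ereal (s + 1 / real (Suc n))"
    show "upper_local_dim \<mu> x \<le> ereal s"
    proof (rule ereal_le_epsilon2)
      fix e :: real assume "0 < e"
      then obtain n where "1 / real (Suc n) < e" by (rule nat_approx_posE)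
      then have "ereal (s + 1 / real (Suc n)) \<le> ereal s + ereal e" by simp
      then show "upper_local_dim \<mu> x \<le> ereal s + ereal e" using * order_trans by blast
    qed
  qed
qed

end

section \<open>Weak approximation by measures with regular ball masses\<close>

lemma borel_measurable_prob:
  fixes f :: "'a::metric_space \<Rightarrow> real"
  assumes "\<mu> \<in> borel_prob_measures K" "continuous_on K f"
  shows "f \<in> borel_measurable \<mu>"
  using borel_measurable_continuous_on_restrict[OF assms(2)] borel_prob_measuresD(2)[OF assms(1)]
  by (simp cong: measurable_cong_sets)

lemma integrable_prob:
  fixes f :: "'a::metric_space \<Rightarrow> real"
  assumes "\<mu> \<in> borel_prob_measures K" "continuous_on K f" "compact K"
  shows "integrable \<mu> f"
proof -
  interpret prob_space \<mu> using assms(1) by (rule borel_prob_measuresD)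
  obtain B where "\<And>x. x \<in> K \<Longrightarrow> norm (f x) \<le> B"
    using compact_imp_bounded[OF compact_continuous_image[OF assms(2,3)]] by (auto simp: bounded_iff)
  then show ?thesis
    using borel_measurable_prob[OF assms(1,2)] borel_prob_measuresD(3)[OF assms(1)]
    by (intro integrable_const_bound[of _ B]) auto
qed

text \<open>Convergence of integrals settles the subbasic sets, and eventual membership passes to
  finite intersections and arbitrary unions. No metric on the space of measures enters.\<close>

lemma eventually_weak_topology:
  fixes K :: "'a::metric_space set"
  assumes \<mu>: "\<And>k. \<mu> k \<in> borel_prob_measures K"
    and lim: "\<And>f :: 'a \<Rightarrow> real. continuous_on K f \<Longrightarrow> (\<lambda>k. \<integral>x. f x \<partial>\<mu> k) \<longlonglongrightarrow> (\<integral>x. f x \<partial>\<nu>)"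
    and T: "openin (weak_topology K) T" "\<nu> \<in> T"
  shows "\<forall>\<^sub>F k in sequentially. \<mu> k \<in> T"
  using T unfolding weak_topology_def openin_topology_generated_by_iff
proof (induction rule: generate_topology_on.induct)
  case (Basis W)
  then obtain f :: "'a \<Rightarrow> real" and U where W: "W = {\<mu> \<in> borel_prob_measures K. (\<integral>x. f x \<partial>\<mu>) \<in> U}"
    "continuous_on K f" "open U" by auto
  then have "\<forall>\<^sub>F k in sequentially. (\<integral>x. f x \<partial>\<mu> k) \<in> U"
    using topological_tendstoD[OF lim[OF W(2)]] Basis(2) by auto
  then show ?case by eventually_elim (simp add: W(1) \<mu>)
next
  case (UN \<K>)
  then obtain k where "k \<in> \<K>" "\<nu> \<in> k" by blast
  then have "\<forall>\<^sub>F j in sequentially. \<mu> j \<in> k" using UN by blast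
  then show ?case by eventually_elim (use \<open>k \<in> \<K>\<close> in blast)
qed (auto intro: eventually_conj)

text \<open>The zero function with the open set \<open>UNIV\<close> makes the whole space one of the
  generators.\<close>

lemma topspace_weak_topology: "topspace (weak_topology K) = borel_prob_measures K"
proof -
  have "borel_prob_measures K = {\<mu> \<in> borel_prob_measures K. (\<integral>x. 0 \<partial>\<mu>) \<in> (UNIV :: real set)}" by simp
  moreover have "bounded ((\<lambda>_. 0 :: real) ` K)" by (auto simp: bounded_iff)
  ultimately have "borel_prob_measures K \<subseteq> topspace (weak_topology K)"
    unfolding weak_topology_def topology_generated_by_topspace
    by (intro Union_upper CollectI exI[of _ "\<lambda>_. 0"] exI[of _ UNIV]) auto
  then show ?thesis unfolding weak_topology_def by auto
qed

lemma integral_indicator_approx: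
  fixes f :: "'a \<Rightarrow> real"
  assumes "finite_measure M" "A \<in> sets M" "integrable M f" "\<And>y. y \<in> A \<Longrightarrow> \<bar>f y - c\<bar> \<le> e"
  shows "\<bar>(\<integral>y. indicator A y * f y \<partial>M) - measure M A * c\<bar> \<le> measure M A * e"
proof -
  interpret finite_measure M by fact
  have int: "integrable M (\<lambda>y. indicator A y * f y)"
    using integrable_mult_indicator[OF assms(2,3)] by simp
  have int': "integrable M (\<lambda>y. indicator A y * d)" for d :: real
    using assms(2) by (intro integrable_mult_left integrable_real_indicator) (auto simp: less_top[symmetric])
  have const: "(\<integral>y. indicator A y * d \<partial>M) = measure M A * d" for d :: real
    using assms(2) by (simp add: sets.Int_space_eq2)
  have "(\<integral>y. indicator A y * f y \<partial>M) - measure M A * c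
      = (\<integral>y. indicator A y * f y - indicator A y * c \<partial>M)"
    using int int' by (subst Bochner_Integration.integral_diff) (auto simp: sets.Int_space_eq2[OF assms(2)])
  also have "\<bar>\<dots>\<bar> \<le> (\<integral>y. indicator A y * e \<partial>M)"
  proof (rule order_trans[OF integral_abs_bound integral_mono])
    show "\<bar>indicator A y * f y - indicator A y * c\<bar> \<le> indicator A y * e" for y
      using assms(4)[of y] by (auto simp: indicator_def)
  qed (use int int' in auto)
  finally show ?thesis unfolding const .
qed

section \<open>Approximation by measures with bounded density with respect to Hausdorff
  measure\<close>

context ahlfors_compact
begin

text \<open>Cut \<open>K\<close> into pieces lying in balls of radius \<open>\<delta>\<close>, and
  spread the \<open>\<nu>\<close>-mass of each piece over its ball in proportion to Hausdorff
  measure. Mass stays within its ball, so integrals change by at most twice the oscillation of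
  \<open>f\<close> at scale \<open>\<delta>\<close>. The density is bounded, so ball masses inherit
  the upper regularity estimate.\<close>

lemma approx_measure:
  assumes \<nu>: "\<nu> \<in> borel_prob_measures K" and \<delta>: "0 < \<delta>" "\<delta> < r0"
  obtains \<mu> C where "\<mu> \<in> borel_prob_measures K"
    "\<And>x r. x \<in> K \<Longrightarrow> 0 < r \<Longrightarrow> r < r0 \<Longrightarrow> measure \<mu> (ball x r \<inter> K) \<le> C * r powr s"
    "\<And>(f :: 'a \<Rightarrow> real) e. continuous_on K f \<Longrightarrow>
      (\<And>x y. x \<in> K \<Longrightarrow> y \<in> K \<Longrightarrow> dist x y < \<delta> \<Longrightarrow> \<bar>f x - f y\<bar> \<le> e) \<Longrightarrow>
      \<bar>(\<integral>x. f x \<partial>\<mu>) - (\<integral>x. f x \<partial>\<nu>)\<bar> \<le> 2 * e"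
proof -
  interpret \<nu>: prob_space \<nu> using \<nu> by (rule borel_prob_measuresD)
  note sets_\<nu> = borel_prob_measuresD(2)[OF \<nu>] and space_\<nu> [simp] = borel_prob_measuresD(3)[OF \<nu>]
  define M where "M = restrict_space (hausdorff_borel s) K"
  have sets_M: "sets M = sets (restrict_space borel K)"
    unfolding M_def by (rule sets_restrict_space_cong) simp
  have space_M [simp]: "space M = K" by (simp add: M_def space_restrict_space)
  have emeasure_M: "emeasure M A = emeasure (hausdorff_borel s) A" if "A \<subseteq> K" for A
    unfolding M_def by (rule emeasure_restrict_space[OF _ that]) simp
  have "finite_measure M"
    using hausdorff_finite emeasure_M[OF order_refl] emeasure_hausdorff_borel[OF borel_K, of s]
    by (intro finite_measureI) simp
  then interpret M: finite_measure M .

  obtain S where S: "finite S" "S \<subseteq> K" "K \<subseteq> (\<Union>x\<in>S. ball x \<delta>)"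
    by (rule compact_separated_net[OF compact order_refl \<delta>(1)]) blast
  obtain x where x: "bij_betw x {..<card S} S"
    using S(1) ex_bij_betw_nat_finite by (metis atLeast0LessThan)
  define N where "N = card S"
  have xK: "x i \<in> K" if "i < N" for i
    using x S(2) that by (auto simp: bij_betw_def N_def)
  have cover: "K \<subseteq> (\<Union>i\<in>{..<N}. ball (x i) \<delta>)"
  proof -
    have "S = x ` {..<N}" using bij_betw_imp_surj_on[OF x] by (simp add: N_def)
    then show ?thesis using S(3) by simp
  qed
  \<comment> \<open>The disjoint pieces \<open>A i\<close> divide up the mass of
    \<open>\<nu>\<close>, but may be null for Hausdorff measure. The new mass is therefore placed on
    the full balls \<open>B i\<close>, where the lower regularity bound makes normalisation
    possible.\<close>
  define A where "A = disjointed (\<lambda>i. ball (x i) \<delta> \<inter> K)"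
  define B where "B i = ball (x i) \<delta> \<inter> K" for i
  have AB: "A i \<subseteq> B i" for i unfolding A_def B_def by (rule disjointed_subset)
  have B_sets [measurable]: "B i \<in> sets M" "B i \<in> sets \<nu>" for i
    unfolding sets_M sets_\<nu> B_def sets_restrict_space by auto
  have A_sets [measurable]: "A i \<in> sets \<nu>" for i
    using sets.range_disjointed_sets'[of "\<lambda>i. ball (x i) \<delta> \<inter> K" \<nu>] B_sets(2)
    unfolding A_def B_def by blast
  have A_sum: "(\<Sum>i<N. indicator (A i) y) = (1 :: real)" if yK: "y \<in> K" for y
  proof -
    obtain i where "i \<in> {0..<N}" "y \<in> ball (x i) \<delta>"
      using subsetD[OF cover yK] by (elim UN_E) simp
    then have "y \<in> (\<Union>i\<in>{0..<N}. A i)"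
      unfolding A_def finite_UN_disjointed_eq using yK by (intro UN_I[of i]) auto
    then have y: "y \<in> (\<Union>i\<in>{..<N}. A i)" by (simp only: atLeast0LessThan)
    have "disjoint_family_on A {..<N}"
      unfolding A_def using disjoint_family_disjointed by (rule disjoint_family_on_mono[rotated]) simp
    then have "indicator (\<Union>i\<in>{..<N}. A i) y = (\<Sum>i<N. indicator (A i) y :: real)"
      by (intro indicator_UN_disjoint) auto
    then show ?thesis using y by simp
  qed
  define w where "w i = measure \<nu> (A i)" for i
  have \<nu>_split: "(\<integral>y. f y \<partial>\<nu>) = (\<Sum>i<N. \<integral>y. indicator (A i) y * f y \<partial>\<nu>)" if "integrable \<nu> f" for f :: "'a \<Rightarrow> real"
  proof -
    have "(\<integral>y. f y \<partial>\<nu>) = (\<integral>y. (\<Sum>i<N. indicator (A i) y * f y) \<partial>\<nu>)"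
      by (intro Bochner_Integration.integral_cong) (auto simp: A_sum simp flip: sum_distrib_right)
    also have "\<dots> = (\<Sum>i<N. \<integral>y. indicator (A i) y * f y \<partial>\<nu>)"
      using integrable_mult_indicator[OF A_sets that] by (intro Bochner_Integration.integral_sum) simp
    finally show ?thesis .
  qed
  have w_sum: "(\<Sum>i<N. w i) = 1"
    using \<nu>_split[of "\<lambda>_. 1"] \<nu>.prob_space sets.Int_space_eq2[OF A_sets] by (simp add: w_def)
  define b where "b i = measure M (B i)" for i
  have b_pos: "0 < b i" if "i < N" for i
  proof -
    have "0 < ennreal (c1 * \<delta> powr s)" using c1_pos \<delta> by simp
    also have "\<dots> \<le> emeasure M (B i)"
      using lower[OF xK[OF that] \<delta>] emeasure_ball[of "x i" \<delta>] by (simp add: emeasure_M B_def Int_commute)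
    finally show ?thesis by (simp add: b_def M.emeasure_eq_measure)
  qed
  define h where "h y = (\<Sum>i<N. w i / b i * indicator (B i) y)" for y
  have h_nonneg: "0 \<le> h y" for y unfolding h_def w_def b_def by (intro sum_nonneg) auto
  have h_meas [measurable]: "h \<in> borel_measurable M" unfolding h_def by measurable
  define \<mu> where "\<mu> = density M (\<lambda>y. ennreal (h y))"
  have \<mu>_integral: "(\<integral>y. f y \<partial>\<mu>) = (\<Sum>i<N. w i / b i * (\<integral>y. indicator (B i) y * f y \<partial>M))"
    if "integrable M f" for f :: "'a \<Rightarrow> real"
  proof -
    have "(\<integral>y. f y \<partial>\<mu>) = (\<integral>y. h y * f y \<partial>M)"
      unfolding \<mu>_def using that h_nonneg by (subst integral_density) auto
    also have "\<dots> = (\<integral>y. (\<Sum>i<N. w i / b i * (indicator (B i) y * f y)) \<partial>M)"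
      by (simp add: h_def sum_distrib_right mult.assoc)
    also have "\<dots> = (\<Sum>i<N. \<integral>y. w i / b i * (indicator (B i) y * f y) \<partial>M)"
      using integrable_mult_indicator[OF B_sets(1) that]
      by (intro Bochner_Integration.integral_sum integrable_mult_right) simp
    finally show ?thesis by (simp only: integral_mult_right_zero)
  qed
  have "emeasure \<mu> (space \<mu>) = (\<integral>\<^sup>+y. ennreal (h y) \<partial>M)"
    unfolding \<mu>_def using sets.top[of M] by (subst emeasure_density) (auto intro!: nn_integral_cong)
  also have "\<dots> = ennreal (\<integral>y. h y \<partial>M)"
    unfolding h_def using h_nonneg[unfolded h_def]
    by (intro nn_integral_eq_integral Bochner_Integration.integrable_sum integrable_mult_right integrable_real_indicator)
      (auto simp: less_top[symmetric])
  \<comment> \<open>The total mass is read off from the integral formula for \<open>\<mu>\<close>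
    with the constant function 1.\<close>
  also have "(\<integral>y. h y \<partial>M) = (\<integral>y. 1 \<partial>\<mu>)"
    unfolding \<mu>_def using h_nonneg by (subst integral_density) auto
  also have "\<dots> = (\<Sum>i<N. w i)"
    using b_pos sets.Int_space_eq2[OF B_sets(1)]
    by (subst \<mu>_integral) (auto intro!: sum.cong simp: b_def[symmetric] less_imp_neq[symmetric])
  finally have "prob_space \<mu>" by (intro prob_spaceI) (simp add: w_sum)
  then have \<mu>: "\<mu> \<in> borel_prob_measures K"
    unfolding borel_prob_measures_def by (simp add: \<mu>_def sets_M)
  interpret \<mu>: prob_space \<mu> by fact
  \<comment> \<open>Bounding all indicators by 1 bounds the density \<open>h\<close> by
    \<open>W\<close>.\<close>
  define W where "W = (\<Sum>i<N. w i / b i)"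
  have W_nonneg: "0 \<le> W" unfolding W_def w_def b_def by (intro sum_nonneg) auto
  have hW: "h y \<le> W" for y
    unfolding h_def W_def w_def b_def by (intro sum_mono) (auto simp: indicator_def)
  have mass: "measure \<mu> (ball y r \<inter> K) \<le> (W * c2) * r powr s" if "y \<in> K" "0 < r" "r < r0" for y r
  proof -
    have X: "ball y r \<inter> K \<in> sets M" unfolding sets_M sets_restrict_space by auto
    have "emeasure \<mu> (ball y r \<inter> K) = (\<integral>\<^sup>+z. ennreal (h z) * indicator (ball y r \<inter> K) z \<partial>M)"
      unfolding \<mu>_def by (rule emeasure_density[OF _ X]) measurable
    also have "\<dots> \<le> (\<integral>\<^sup>+z. ennreal W * indicator (ball y r \<inter> K) z \<partial>M)"
      using hW by (intro nn_integral_mono mult_right_mono ennreal_leI) auto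
    also have "\<dots> = ennreal W * emeasure M (ball y r \<inter> K)"
      using X by (simp add: nn_integral_cmult_indicator)
    also have "\<dots> \<le> ennreal W * ennreal (c2 * r powr s)"
      using upper[OF that] emeasure_ball[of y r] by (intro mult_left_mono) (auto simp: emeasure_M Int_commute)
    also have "\<dots> = ennreal (W * c2 * r powr s)"
      using W_nonneg c2_pos by (simp add: ennreal_mult[symmetric] mult.assoc)
    finally show ?thesis using W_nonneg c2_pos by (simp add: \<mu>.emeasure_eq_measure ennreal_le_iff)
  qed
  have close: "\<bar>(\<integral>y. f y \<partial>\<mu>) - (\<integral>y. f y \<partial>\<nu>)\<bar> \<le> 2 * e"
    if f: "continuous_on K f" and e: "\<And>x y. x \<in> K \<Longrightarrow> y \<in> K \<Longrightarrow> dist x y < \<delta> \<Longrightarrow> \<bar>f x - f y\<bar> \<le> e"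
    for f :: "'a \<Rightarrow> real" and e
  proof -
    have int_\<nu>: "integrable \<nu> f" by (rule integrable_prob[OF \<nu> f compact])
    obtain D where "\<And>x. x \<in> K \<Longrightarrow> norm (f x) \<le> D"
      using compact_imp_bounded[OF compact_continuous_image[OF f compact]] by (auto simp: bounded_iff)
    moreover have "f \<in> borel_measurable M"
      using borel_measurable_continuous_on_restrict[OF f] sets_M by (simp cong: measurable_cong_sets)
    ultimately have int_M: "integrable M f"
      by (intro M.integrable_const_bound[of _ D]) auto
    have osc: "\<bar>f y - f (x i)\<bar> \<le> e" if "y \<in> B i" "i < N" for y i
      using that xK e[of y "x i"] by (auto simp: B_def dist_commute)
    \<comment> \<open>Both integrals are compared with \<open>w i * f (x i)\<close>, the value at
      the common centre; each comparison costs \<open>w i * e\<close>.\<close>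
    have "\<bar>w i / b i * (\<integral>y. indicator (B i) y * f y \<partial>M) - (\<integral>y. indicator (A i) y * f y \<partial>\<nu>)\<bar> \<le> w i * (2 * e)"
      if i: "i < N" for i
    proof -
      have b: "0 < b i" using b_pos i .
      have "\<bar>(\<integral>y. indicator (B i) y * f y \<partial>M) - b i * f (x i)\<bar> \<le> b i * e"
        unfolding b_def
        by (rule integral_indicator_approx[OF M.finite_measure_axioms B_sets(1) int_M osc[OF _ i]])
      then have "w i / b i * \<bar>(\<integral>y. indicator (B i) y * f y \<partial>M) - b i * f (x i)\<bar> \<le> w i / b i * (b i * e)"
        using b by (intro mult_left_mono) (auto simp: w_def)
      also have "w i / b i * \<bar>(\<integral>y. indicator (B i) y * f y \<partial>M) - b i * f (x i)\<bar>
          = \<bar>w i / b i * ((\<integral>y. indicator (B i) y * f y \<partial>M) - b i * f (x i))\<bar>"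
        using b by (simp add: w_def abs_mult)
      also have "w i / b i * ((\<integral>y. indicator (B i) y * f y \<partial>M) - b i * f (x i))
          = w i / b i * (\<integral>y. indicator (B i) y * f y \<partial>M) - w i * f (x i)"
        using b by (simp add: right_diff_distrib)
      finally have 1: "\<bar>w i / b i * (\<integral>y. indicator (B i) y * f y \<partial>M) - w i * f (x i)\<bar> \<le> w i * e"
        using b by simp
      have "\<bar>(\<integral>y. indicator (A i) y * f y \<partial>\<nu>) - w i * f (x i)\<bar> \<le> w i * e"
        unfolding w_def
      proof (rule integral_indicator_approx[OF \<nu>.finite_measure_axioms A_sets int_\<nu>])
        show "\<bar>f y - f (x i)\<bar> \<le> e" if "y \<in> A i" for y
          by (rule osc[OF subsetD[OF AB that] i])
      qed
      with 1 show ?thesis by linarith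
    qed
    then have "(\<Sum>i<N. \<bar>w i / b i * (\<integral>y. indicator (B i) y * f y \<partial>M) - (\<integral>y. indicator (A i) y * f y \<partial>\<nu>)\<bar>)
        \<le> (\<Sum>i<N. w i * (2 * e))" by (intro sum_mono) auto
    then have "\<bar>\<Sum>i<N. w i / b i * (\<integral>y. indicator (B i) y * f y \<partial>M) - (\<integral>y. indicator (A i) y * f y \<partial>\<nu>)\<bar>
        \<le> (\<Sum>i<N. w i * (2 * e))"
      by (rule order_trans[OF sum_abs])
    then show ?thesis
      by (simp add: \<mu>_integral[OF int_M] \<nu>_split[OF int_\<nu>] sum_subtractf sum_distrib_right[symmetric] w_sum)
  qed
  show thesis using that[OF \<mu> mass close] .
qed

end

section \<open>Typical measures\<close>

text \<open>A continuous substitute for the indicator of a ball: 1 up to distance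
  \<open>2 * r\<close> and 0 from \<open>3 * r\<close> on. The plateau reaches \<open>2 * r\<close>
  so that one tent dominates the indicators of all balls of radius \<open>r\<close> whose centre is
  within \<open>r\<close> of \<open>x\<close>; a finite net of tents thus controls every
  ball.\<close>

definition tent :: "'a::metric_space \<Rightarrow> real \<Rightarrow> 'a \<Rightarrow> real" where
  "tent x r y = max 0 (min 1 (3 - dist x y / r))"

lemma continuous_on_tent: "0 < r \<Longrightarrow> continuous_on A (tent x r)"
  unfolding tent_def by (intro continuous_intros) auto

lemma tent_bounds: "0 \<le> tent x r y" "tent x r y \<le> 1"
  by (auto simp: tent_def)

lemma tent_eq_1:
  assumes "0 < r" "dist x y \<le> 2 * r"
  shows "tent x r y = 1"
proof -
  have "dist x y / r \<le> 2" using assms by (simp add: pos_divide_le_eq)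
  then show ?thesis by (simp add: tent_def)
qed

lemma tent_eq_0:
  assumes "0 < r" "3 * r \<le> dist x y"
  shows "tent x r y = 0"
proof -
  have "3 \<le> dist x y / r" using assms by (simp add: pos_le_divide_eq)
  then show ?thesis by (simp add: tent_def)
qed

lemma integral_tent_le:
  assumes "\<mu> \<in> borel_prob_measures K" "compact K" "0 < r"
  shows "(\<integral>y. tent x r y \<partial>\<mu>) \<le> measure \<mu> (ball x (3 * r) \<inter> K)"
proof -
  interpret prob_space \<mu> using assms(1) by (rule borel_prob_measuresD)
  note space = borel_prob_measuresD(3)[OF assms(1)]
  have B: "ball x (3 * r) \<inter> K \<in> sets \<mu>" by (rule sets_borel_prob_measure[OF assms(1)]) auto
  have "(\<integral>y. tent x r y \<partial>\<mu>) \<le> (\<integral>y. indicator (ball x (3 * r) \<inter> K) y \<partial>\<mu>)"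
  proof (rule integral_mono)
    show "integrable \<mu> (tent x r)"
      using assms by (intro integrable_prob continuous_on_tent)
    show "integrable \<mu> (indicator (ball x (3 * r) \<inter> K) :: _ \<Rightarrow> real)"
      using B by (intro integrable_real_indicator) (auto simp: less_top[symmetric])
    show "tent x r y \<le> indicator (ball x (3 * r) \<inter> K) y" if "y \<in> space \<mu>" for y
      using that tent_bounds[of x r y] tent_eq_0[OF assms(3), of x y]
      by (cases "y \<in> ball x (3 * r)") (auto simp: space)
  qed
  also have "\<dots> = measure \<mu> (ball x (3 * r) \<inter> K)"
    using sets.Int_space_eq2[OF B] by simp
  finally show ?thesis .
qed

lemma measure_le_integral_tent:
  assumes "\<mu> \<in> borel_prob_measures K" "compact K" "0 < r" "dist z x \<le> r"
  shows "measure \<mu> (ball x r \<inter> K) \<le> (\<integral>y. tent z r y \<partial>\<mu>)"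
proof -
  interpret prob_space \<mu> using assms(1) by (rule borel_prob_measuresD)
  have B: "ball x r \<inter> K \<in> sets \<mu>" by (rule sets_borel_prob_measure[OF assms(1)]) auto
  have "measure \<mu> (ball x r \<inter> K) = (\<integral>y. indicator (ball x r \<inter> K) y \<partial>\<mu>)"
    using sets.Int_space_eq2[OF B] by simp
  also have "\<dots> \<le> (\<integral>y. tent z r y \<partial>\<mu>)"
  proof (rule integral_mono)
    show "integrable \<mu> (tent z r)"
      using assms by (intro integrable_prob continuous_on_tent)
    show "integrable \<mu> (indicator (ball x r \<inter> K) :: _ \<Rightarrow> real)"
      using B by (intro integrable_real_indicator) (auto simp: less_top[symmetric])
    show "indicator (ball x r \<inter> K) y \<le> tent z r y" for y
    proof (cases "y \<in> ball x r \<inter> K")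
      case True
      then have "dist z y \<le> 2 * r" using assms(4) dist_triangle[of z y x] by simp
      then have "tent z r y = 1" by (rule tent_eq_1[OF assms(3)])
      then show ?thesis by (simp add: indicator_def)
    qed (simp add: tent_bounds)
  qed
  finally show ?thesis .
qed

lemma openin_integral_less:
  fixes f :: "'a::topological_space \<Rightarrow> real"
  assumes "continuous_on K f" "compact K"
  shows "openin (weak_topology K) {\<mu> \<in> borel_prob_measures K. (\<integral>y. f y \<partial>\<mu>) < c}"
proof -
  have "bounded (f ` K)"
    using assms by (intro compact_imp_bounded compact_continuous_image)
  then show ?thesis
    unfolding weak_topology_def using assms
    by (intro topology_generated_by_Basis CollectI exI[of _ f] exI[of _ "{..<c}"]) auto
qed

section \<open>The dense G_delta set of measures\<close>

context ahlfors_compact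
begin

lemma typical_upper_local_dim:
  "typical_in (weak_topology K) (\<lambda>\<mu>. AE x in \<mu>. upper_local_dim \<mu> x = ereal s)"
proof -
  \<comment> \<open>One net is fixed for each radius, so that the open sets below do not depend on
    the measure.\<close>
  have "\<exists>S. finite S \<and> S \<subseteq> K \<and> K \<subseteq> (\<Union>x\<in>S. ball x r)" if "0 < r" for r
    using compact_separated_net[OF compact order_refl that] by metis
  then obtain net where net: "\<And>r. 0 < r \<Longrightarrow> finite (net r)" "\<And>r. 0 < r \<Longrightarrow> net r \<subseteq> K"
    "\<And>r. 0 < r \<Longrightarrow> K \<subseteq> (\<Union>x\<in>net r. ball x r)" by metis
  \<comment> \<open>Finiteness of the net makes this set open. The last factor keeps it inside the
    space when the net is empty.\<close>
  define V where "V r t = (\<Inter>x\<in>net r. {\<mu> \<in> borel_prob_measures K. (\<integral>y. tent x r y \<partial>\<mu>) < r powr t})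
    \<inter> borel_prob_measures K" for r t
  have V_open: "openin (weak_topology K) (V r t)" if "0 < r" for r t
    unfolding V_def topspace_weak_topology[symmetric]
    using net(1)[OF that] that compact
    by (intro openin_INT) (simp_all add: topspace_weak_topology openin_integral_less continuous_on_tent)
  define U where "U n = (\<Union>r\<in>{0<..<1 / real (Suc n)}. V r (s - 1 / real (Suc n)))" for n
  have U_open: "openin (weak_topology K) (U n)" for n
    unfolding U_def using V_open by (intro openin_Union) auto
  define G where "G = (\<Inter>n. U n)"
  have gdelta: "gdelta_in (weak_topology K) G"
    unfolding G_def using U_open by (intro gdelta_in_Inter) (auto intro: open_imp_gdelta_in)

  have reg: "\<mu> \<in> G"
    if \<mu>: "\<mu> \<in> borel_prob_measures K"
      and mass: "\<And>x r. x \<in> K \<Longrightarrow> 0 < r \<Longrightarrow> r < r0 \<Longrightarrow> measure \<mu> (ball x r \<inter> K) \<le> C * r powr s" for \<mu> C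
  proof -
    have "\<mu> \<in> U n" for n
    proof -
      define e where "e = 1 / real (Suc n)"
      have "0 < e" by (simp add: e_def)
      \<comment> \<open>The mass of a ball of radius \<open>3 * r\<close> is at most
        \<open>C * 3 powr s * r powr e\<close> times \<open>r powr (s - e)\<close>; the first factor
        tends to 0 and so is eventually below 1.\<close>
      have "((\<lambda>r. C * 3 powr s * r powr e) \<longlongrightarrow> C * 3 powr s * 0) (at_right 0)"
        using \<open>0 < e\<close> by (intro tendsto_mult tendsto_const tendsto_zero_powrI[where b=e])
          (auto simp: eventually_at_right_field intro: tendsto_ident_at gt_ex)
      then have "\<forall>\<^sub>F r in at_right 0. C * 3 powr s * r powr e < 1"
        by (intro order_tendstoD) auto
      moreover have "\<forall>\<^sub>F r in at_right 0. r < min e (r0 / 3)"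
        using \<open>0 < e\<close> r0_pos unfolding eventually_at_right_field by (intro exI[of _ "min e (r0 / 3)"]) auto
      moreover have "\<forall>\<^sub>F r :: real in at_right 0. 0 < r"
        by (simp add: eventually_at_right_less)
      ultimately have "\<forall>\<^sub>F r in at_right 0. C * 3 powr s * r powr e < 1 \<and> r < min e (r0 / 3) \<and> 0 < r"
        by eventually_elim auto
      then obtain r where r: "C * 3 powr s * r powr e < 1" "r < e" "3 * r < r0" "0 < r"
        using eventually_happens'[OF trivial_limit_at_right_real] by fastforce
      have "(\<integral>y. tent x r y \<partial>\<mu>) < r powr (s - e)" if "x \<in> net r" for x
      proof -
        have "(\<integral>y. tent x r y \<partial>\<mu>) \<le> measure \<mu> (ball x (3 * r) \<inter> K)"
          by (rule integral_tent_le[OF \<mu> compact r(4)])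
        also have "\<dots> \<le> C * (3 * r) powr s"
          using that net(2)[OF r(4)] r by (intro mass) auto
        also have "\<dots> = C * 3 powr s * r powr e * r powr (s - e)"
          using r by (simp add: powr_mult powr_diff)
        also have "\<dots> < 1 * r powr (s - e)"
          using r by (intro mult_strict_right_mono) auto
        finally show ?thesis by simp
      qed
      then have "\<mu> \<in> V r (s - e)" using \<mu> by (simp add: V_def)
      then show ?thesis using r by (auto simp: U_def e_def)
    qed
    then show ?thesis by (simp add: G_def)
  qed

  have "\<nu> \<in> weak_topology K closure_of G" if \<nu>: "\<nu> \<in> borel_prob_measures K" for \<nu>
  proof -
    \<comment> \<open>The shift by 2 gives \<open>\<delta> k < r0\<close> already for
      \<open>k = 0\<close>.\<close>
    define \<delta> where "\<delta> k = r0 / real (k + 2)" for k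
    have \<delta>: "0 < \<delta> k" "\<delta> k < r0" for k using r0_pos by (auto simp: \<delta>_def divide_less_eq)
    have "\<exists>\<mu>\<in>G \<inter> borel_prob_measures K. \<forall>(f :: 'a \<Rightarrow> real) e. continuous_on K f \<longrightarrow>
      (\<forall>x\<in>K. \<forall>y\<in>K. dist x y < \<delta> k \<longrightarrow> \<bar>f x - f y\<bar> \<le> e) \<longrightarrow>
      \<bar>(\<integral>x. f x \<partial>\<mu>) - (\<integral>x. f x \<partial>\<nu>)\<bar> \<le> 2 * e" for k
      by (rule approx_measure[OF \<nu> \<delta>]) (use reg in blast)
    then obtain \<mu> where \<mu>: "\<And>k. \<mu> k \<in> G" "\<And>k. \<mu> k \<in> borel_prob_measures K"
      "\<And>k (f :: 'a \<Rightarrow> real) e. continuous_on K f \<Longrightarrow>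
        (\<forall>x\<in>K. \<forall>y\<in>K. dist x y < \<delta> k \<longrightarrow> \<bar>f x - f y\<bar> \<le> e) \<Longrightarrow>
        \<bar>(\<integral>x. f x \<partial>\<mu> k) - (\<integral>x. f x \<partial>\<nu>)\<bar> \<le> 2 * e"
      by (metis IntE)
    have lim: "(\<lambda>k. \<integral>x. f x \<partial>\<mu> k) \<longlonglongrightarrow> (\<integral>x. f x \<partial>\<nu>)" if f: "continuous_on K f" for f :: "'a \<Rightarrow> real"
    proof (rule tendstoI)
      fix e :: real assume "0 < e"
      \<comment> \<open>Uniform continuity with tolerance \<open>e / 3\<close> leaves an error of
        \<open>2 * (e / 3)\<close>, strictly below \<open>e\<close>.\<close>
      obtain d where d: "0 < d" "\<And>x y. x \<in> K \<Longrightarrow> y \<in> K \<Longrightarrow> dist x y < d \<Longrightarrow> dist (f x) (f y) < e / 3"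
        using compact_uniformly_continuous[OF f compact] \<open>0 < e\<close>
        unfolding uniformly_continuous_on_def by (metis dist_commute zero_less_divide_iff zero_less_numeral)
      have "(\<lambda>k. r0 / real (k + 2)) \<longlonglongrightarrow> 0"
        by (rule LIMSEQ_ignore_initial_segment[OF lim_const_over_n])
      then have "\<forall>\<^sub>F k in sequentially. \<delta> k < d"
        unfolding \<delta>_def using d(1) by (rule order_tendstoD)
      then show "\<forall>\<^sub>F k in sequentially. dist (\<integral>x. f x \<partial>\<mu> k) (\<integral>x. f x \<partial>\<nu>) < e"
      proof eventually_elim
        fix k assume "\<delta> k < d"
        then have "\<forall>x\<in>K. \<forall>y\<in>K. dist x y < \<delta> k \<longrightarrow> \<bar>f x - f y\<bar> \<le> e / 3"
          using d(2) by (fastforce simp: dist_real_def)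
        then have "\<bar>(\<integral>x. f x \<partial>\<mu> k) - (\<integral>x. f x \<partial>\<nu>)\<bar> \<le> 2 * (e / 3)" by (rule \<mu>(3)[OF f])
        then show "dist (\<integral>x. f x \<partial>\<mu> k) (\<integral>x. f x \<partial>\<nu>) < e"
          using \<open>0 < e\<close> by (simp add: dist_real_def)
      qed
    qed
    have "\<exists>y\<in>G. y \<in> T" if "openin (weak_topology K) T" "\<nu> \<in> T" for T
    proof -
      have "\<forall>\<^sub>F k in sequentially. \<mu> k \<in> T"
        by (rule eventually_weak_topology[OF \<mu>(2) lim that])
      then obtain k where "\<mu> k \<in> T" by (auto simp: eventually_sequentially)
      then show ?thesis using \<mu>(1) by blast
    qed
    then show ?thesis using \<nu> by (auto simp: in_closure_of topspace_weak_topology)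
  qed
  then have dense: "weak_topology K closure_of G = topspace (weak_topology K)"
    using closure_of_subset_topspace[of "weak_topology K" G] by (auto simp: topspace_weak_topology)

  have "AE x in \<mu>. upper_local_dim \<mu> x = ereal s" if "\<mu> \<in> G" for \<mu>
  proof -
    have \<mu>: "\<mu> \<in> borel_prob_measures K"
      using gdelta_in_subset[OF gdelta] that by (auto simp: topspace_weak_topology)
    have [simp]: "space \<mu> = K" by (rule borel_prob_measuresD(3)[OF \<mu>])
    have "ereal s \<le> upper_local_dim \<mu> x" if x: "x \<in> K" for x
    proof (rule ccontr)
      assume "\<not> ?thesis"
      then obtain z where z: "upper_local_dim \<mu> x < ereal z" "z < s"
        using ereal_dense2[of "upper_local_dim \<mu> x" "ereal s"] by (auto simp: not_le)
      then have "\<forall>\<^sub>F r in at_right 0. ln_ereal (measure \<mu> (ball x r \<inter> K)) / ereal (ln r) < ereal z"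
        unfolding upper_local_dim_def using Limsup_lessD by force
      then obtain d where d: "0 < d"
        "\<And>r. 0 < r \<Longrightarrow> r < d \<Longrightarrow> ln_ereal (measure \<mu> (ball x r \<inter> K)) / ereal (ln r) < ereal z"
        by (auto simp: eventually_at_right_field)
      \<comment> \<open>This \<open>n\<close> forces the scale supplied by \<open>U n\<close> below
        \<open>d\<close>, and makes the exponent \<open>s - 1/(n+1)\<close> exceed
        \<open>z\<close>.\<close>
      obtain n where n: "1 / real (Suc n) < min d (s - z)"
        using d(1) z(2) nat_approx_posE[of "min d (s - z)"] by auto
      have "\<mu> \<in> U n" using \<open>\<mu> \<in> G\<close> by (simp add: G_def)
      then obtain r where r: "0 < r" "r < 1 / real (Suc n)" "\<mu> \<in> V r (s - 1 / real (Suc n))"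
        by (auto simp: U_def)
      have "1 / real (Suc n) \<le> 1" by simp
      then have "r < 1" using r(2) by linarith
      \<comment> \<open>The tent at the nearby net point \<open>y\<close> dominates the indicator of
        the ball about \<open>x\<close>, which gives the estimate at every point of \<open>K\<close>
        and not only on the net.\<close>
      obtain y where y: "y \<in> net r" "dist y x < r"
        using net(3)[OF r(1)] x by auto
      have "measure \<mu> (ball x r \<inter> K) \<le> (\<integral>w. tent y r w \<partial>\<mu>)"
        using y by (intro measure_le_integral_tent[OF \<mu> compact r(1)]) auto
      also have "\<dots> \<le> r powr (s - 1 / real (Suc n))"
        using r(3) y(1) by (auto simp: V_def)
      finally have "ereal (s - 1 / real (Suc n)) \<le> ln_ereal (measure \<mu> (ball x r \<inter> K)) / ereal (ln r)"
        using r(1) \<open>r < 1\<close> by (intro local_ratio_ge) auto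
      also have "\<dots> < ereal z" using d(2)[OF r(1)] r(2) n by simp
      finally show False using n by simp
    qed
    then have "AE x in \<mu>. ereal s \<le> upper_local_dim \<mu> x" by (intro AE_I2) simp
    then show ?thesis using AE_upper_local_dim_le[OF \<mu>] by eventually_elim (rule antisym)
  qed
  then show ?thesis unfolding typical_in_def using gdelta dense by blast
qed

end

theorem corollary1p4:
  fixes K :: "'a::euclidean_space set"
  assumes "compact K" and "ahlfors_regular K"
  shows "typical_in (weak_topology K) (\<lambda>\<mu>. AE x in \<mu>. upper_local_dim \<mu> x = packing_dim K)"
proof -
  obtain s c1 c2 r0 where dim: "hausdorff_dim K = ereal s" and "ahlfors_compact K s c1 c2 r0"
    using assms unfolding ahlfors_regular_def ahlfors_compact_def by blast
  then interpret ahlfors_compact K s c1 c2 r0 by simp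
  \<comment> \<open>The packing dimension is squeezed between the Hausdorff dimension, which is
    \<open>s\<close>, and the upper bound \<open>s\<close> from counting packings.\<close>
  have "packing_dim K = ereal s"
    using hausdorff_dim_le_packing_dim[OF compact] packing_dim_le dim by (intro antisym) auto
  then show ?thesis using typical_upper_local_dim by simp
qed

end
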